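(* There exists a polynomial-time Turing reduction from $\mathrm{PF}$ to $\mathrm{dPF}$, where the dPF oracle may be called on magnified energy models $\mathcal{M}'$ with $\Delta G^{\mathcal{M}'}=\alpha\cdot\Delta G^{\mathcal{M}}$ for a positive real $\alpha$ computed by the reduction.
   Context: A nucleic acid strand is a word over $\{A,C,G,T\}$; inputs may be a single strand or a multiset of strands, $n$ the total number of bases. A secondary structure is a set of complementary base pairs with each base in at most one pair; $\Omega_s$ is the set of secondary structures under interest of $s$. An energy model $\mathcal{M}$ is part of the problem input and assigns $\Delta G^{\mathcal{M}}(S,T)\in\mathbb{R}$ to each $S\in\Omega_s$ at temperature $T$; magnification by $\alpha>0$ multiplies all energies by $\alpha$. PF: given $(s,T,\mathcal{M})$ output $\mathrm{PF}(s,T,\mathcal{M})=\sum_{S\in\Omega_s}e^{-\Delta G^{\mathcal{M}}(S,T)/k_BT}$. dPF: given $(s,T,\mathcal{M},k)$ decide whether $\mathrm{PF}(s,T,\mathcal{M})\ge k$. Standing assumption: there is a set of candidate energy levels (a finite superset of $\{\Delta G^{\mathcal{M}}(S):S\in\Omega_s\}$) of size polynomial in $n$, computable in polynomial time, consisting of rationals with $O(\log n)$-digit precision. A polynomial-time Turing reduction from $A$ to $B$ solves $A$ using polynomially many calls to an oracle for $B$ and polynomial additional time. *)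

theory Defs
  imports Complex_Main "HOL-Library.Log_Nat" "HOL-Computational_Algebra.Polynomial"
begin

section \<open>Polynomial time with an oracle\<close>

text \<open>
  The machine model is a WHILE language over finite binary trees with integer leaves, with an
  instruction that queries an oracle.  Cost is bit cost: evaluating a node of an expression costs
  at least the size of the value produced there, so no value (in particular no oracle query)
  is larger than the time spent, and every operation charged is computable by a Turing machine in
  time polynomial in its charge.  Polynomial time in this model is therefore polynomial time on
  (oracle) Turing machines.
\<close>

datatype val = I int | P val val

fun vsize :: "val \<Rightarrow> nat" where
  "vsize (I i) = 1 + floorlog 2 (nat \<bar>i\<bar>)"
| "vsize (P a b) = 1 + vsize a + vsize b"

fun as_int :: "val \<Rightarrow> int" where
  "as_int (I i) = i"
| "as_int (P a b) = 0"

fun left :: "val \<Rightarrow> val" where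
  "left (P a b) = a"
| "left (I i) = I 0"

fun right :: "val \<Rightarrow> val" where
  "right (P a b) = b"
| "right (I i) = I 0"

fun is_pair :: "val \<Rightarrow> bool" where
  "is_pair (P a b) = True"
| "is_pair (I i) = False"

definition truth :: "bool \<Rightarrow> val" where
  "truth b = I (if b then 1 else 0)"

datatype pexp =
    Var nat | Const int
  | MkPair pexp pexp | Left pexp | Right pexp | IsPair pexp
  | Add pexp pexp | Sub pexp pexp | Mul pexp pexp | Div pexp pexp | Less pexp pexp

type_synonym state = "nat \<Rightarrow> val"

fun peval :: "pexp \<Rightarrow> state \<Rightarrow> val" where
  "peval (Var x) s = s x"
| "peval (Const i) s = I i"
| "peval (MkPair a b) s = P (peval a s) (peval b s)"
| "peval (Left a) s = left (peval a s)"
| "peval (Right a) s = right (peval a s)"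
| "peval (IsPair a) s = truth (is_pair (peval a s))"
| "peval (Add a b) s = I (as_int (peval a s) + as_int (peval b s))"
| "peval (Sub a b) s = I (as_int (peval a s) - as_int (peval b s))"
| "peval (Mul a b) s = I (as_int (peval a s) * as_int (peval b s))"
| "peval (Div a b) s = I (as_int (peval a s) div as_int (peval b s))"
| "peval (Less a b) s = truth (as_int (peval a s) < as_int (peval b s))"

fun subexps :: "pexp \<Rightarrow> pexp list" where
  "subexps (MkPair a b) = [a, b]"
| "subexps (Left a) = [a]"
| "subexps (Right a) = [a]"
| "subexps (IsPair a) = [a]"
| "subexps (Add a b) = [a, b]"
| "subexps (Sub a b) = [a, b]"
| "subexps (Mul a b) = [a, b]"
| "subexps (Div a b) = [a, b]"
| "subexps (Less a b) = [a, b]"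
| "subexps (Var x) = []"
| "subexps (Const i) = []"

lemma subexps_size [termination_simp]: "a \<in> set (subexps e) \<Longrightarrow> size a < size e"
  by (cases e) auto

fun pcost :: "pexp \<Rightarrow> state \<Rightarrow> nat" where
  "pcost e s = vsize (peval e s) + (\<Sum>a\<leftarrow>subexps e. pcost a s)"

declare pcost.simps [simp del]

datatype com =
    Skip
  | Assign nat pexp
  | Seq com com
  | Cond pexp com com
  | While pexp com
  | Ask nat pexp

text \<open>\<open>exec Q c s n t\<close>: with oracle \<open>Q\<close>, the command \<open>c\<close> started in \<open>s\<close> halts in \<open>t\<close> at cost \<open>n\<close>.\<close>

inductive exec :: "val set \<Rightarrow> com \<Rightarrow> state \<Rightarrow> nat \<Rightarrow> state \<Rightarrow> bool" for Q where
  Skip: "exec Q Skip s 1 s"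
| Assign: "exec Q (Assign x e) s (1 + pcost e s) (s(x := peval e s))"
| Seq: "exec Q c s m u \<Longrightarrow> exec Q d u n t \<Longrightarrow> exec Q (Seq c d) s (1 + m + n) t"
| CondTrue: "peval e s \<noteq> I 0 \<Longrightarrow> exec Q c s n t \<Longrightarrow> exec Q (Cond e c d) s (1 + pcost e s + n) t"
| CondFalse: "peval e s = I 0 \<Longrightarrow> exec Q d s n t \<Longrightarrow> exec Q (Cond e c d) s (1 + pcost e s + n) t"
| WhileFalse: "peval e s = I 0 \<Longrightarrow> exec Q (While e c) s (1 + pcost e s) s"
| WhileTrue: "peval e s \<noteq> I 0 \<Longrightarrow> exec Q c s m u \<Longrightarrow> exec Q (While e c) u n t \<Longrightarrow>
    exec Q (While e c) s (1 + pcost e s + m + n) t"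
| Ask: "exec Q (Ask x e) s (1 + pcost e s) (s(x := truth (peval e s \<in> Q)))"

inductive_cases exec_elims:
  "exec Q Skip s n t" "exec Q (Assign x e) s n t" "exec Q (Seq c d) s n t"
  "exec Q (Cond e c d) s n t" "exec Q (Ask x e) s n t"
inductive_cases exec_WhileE: "exec Q (While e c) s n t"

lemma exec_deterministic:
  "exec Q c s n t \<Longrightarrow> exec Q c s n' t' \<Longrightarrow> n' = n \<and> t' = t"
proof (induction arbitrary: n' t' rule: exec.induct)
  case (WhileFalse e s c)
  then show ?case by (auto elim: exec_WhileE)
next
  case (WhileTrue e s c m u n t)
  from WhileTrue.prems WhileTrue.hyps(1) obtain m' u' k'
    where "exec Q c s m' u'" "exec Q (While e c) u' k' t'" "n' = 1 + pcost e s + m' + k'"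
    by (auto elim: exec_WhileE)
  with WhileTrue.IH show ?case by blast
next
  case (Seq c s m u d n t)
  from Seq.prems obtain m' u' k'
    where "exec Q c s m' u'" "exec Q d u' k' t'" "n' = 1 + m' + k'"
    by (auto elim: exec_elims)
  with Seq.IH show ?case by blast
next
  case (CondTrue e s c n t d)
  then obtain k' where "exec Q c s k' t'" "n' = 1 + pcost e s + k'"
    by (auto elim: exec_elims)
  with CondTrue.IH show ?case by blast
next
  case (CondFalse e s d n t c)
  then obtain k' where "exec Q d s k' t'" "n' = 1 + pcost e s + k'"
    by (auto elim: exec_elims)
  with CondFalse.IH show ?case by blast
qed (auto elim: exec_elims)

fun oracle_free :: "com \<Rightarrow> bool" where
  "oracle_free (Ask x e) = False"
| "oracle_free (Seq c d) = (oracle_free c \<and> oracle_free d)"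
| "oracle_free (Cond e c d) = (oracle_free c \<and> oracle_free d)"
| "oracle_free (While e c) = oracle_free c"
| "oracle_free Skip = True"
| "oracle_free (Assign x e) = True"

definition init :: "val \<Rightarrow> state" where
  "init v = (\<lambda>_. I 0)(0 := v)"

text \<open>
  A computational problem is a set \<open>D\<close> of inputs, an encoding \<open>enc\<close> of inputs, and a relation
  \<open>ok x v\<close> saying that \<open>v\<close> is a correct output on input \<open>x\<close>.
\<close>

definition solves_in_polytime ::
    "val set \<Rightarrow> com \<Rightarrow> 'x set \<Rightarrow> ('x \<Rightarrow> val) \<Rightarrow> ('x \<Rightarrow> val \<Rightarrow> bool) \<Rightarrow> bool" where
  "solves_in_polytime Q c D enc ok \<longleftrightarrow>
     (\<exists>p :: nat poly. \<forall>x\<in>D. \<exists>n t.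
        exec Q c (init (enc x)) n t \<and> n \<le> poly p (vsize (enc x)) \<and> ok x (t 0))"

definition polytime_solvable :: "'x set \<Rightarrow> ('x \<Rightarrow> val) \<Rightarrow> ('x \<Rightarrow> val \<Rightarrow> bool) \<Rightarrow> bool" where
  "polytime_solvable D enc ok \<longleftrightarrow> (\<exists>c. oracle_free c \<and> solves_in_polytime {} c D enc ok)"

text \<open>Every oracle call costs at least 1, so the number of calls is polynomial as well.\<close>

definition polytime_Turing_reducible ::
    "'x set \<Rightarrow> ('x \<Rightarrow> val) \<Rightarrow> ('x \<Rightarrow> val \<Rightarrow> bool) \<Rightarrow> val set \<Rightarrow> bool" where
  "polytime_Turing_reducible D enc ok Q \<longleftrightarrow> (\<exists>c. solves_in_polytime Q c D enc ok)"


section \<open>Exact finite descriptions of real numbers\<close>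

text \<open>
  Partition functions, magnification factors and thresholds are reals; programs write them exactly,
  as closed expressions.  \<open>Boltz\<close> denotes the Boltzmann constant.
\<close>

datatype rexp =
    Num int | Boltz
  | RAdd rexp rexp | RSub rexp rexp | RMul rexp rexp | RDiv rexp rexp
  | RExp rexp | RLn rexp

fun reval :: "real \<Rightarrow> rexp \<Rightarrow> real" where
  "reval kB (Num i) = of_int i"
| "reval kB Boltz = kB"
| "reval kB (RAdd a b) = reval kB a + reval kB b"
| "reval kB (RSub a b) = reval kB a - reval kB b"
| "reval kB (RMul a b) = reval kB a * reval kB b"
| "reval kB (RDiv a b) = reval kB a / reval kB b"
| "reval kB (RExp a) = exp (reval kB a)"
| "reval kB (RLn a) = ln (reval kB a)"

fun well_defined :: "real \<Rightarrow> rexp \<Rightarrow> bool" where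
  "well_defined kB (Num i) \<longleftrightarrow> True"
| "well_defined kB Boltz \<longleftrightarrow> True"
| "well_defined kB (RAdd a b) \<longleftrightarrow> well_defined kB a \<and> well_defined kB b"
| "well_defined kB (RSub a b) \<longleftrightarrow> well_defined kB a \<and> well_defined kB b"
| "well_defined kB (RMul a b) \<longleftrightarrow> well_defined kB a \<and> well_defined kB b"
| "well_defined kB (RDiv a b) \<longleftrightarrow> well_defined kB a \<and> well_defined kB b \<and> reval kB b \<noteq> 0"
| "well_defined kB (RExp a) \<longleftrightarrow> well_defined kB a"
| "well_defined kB (RLn a) \<longleftrightarrow> well_defined kB a \<and> reval kB a > 0"

fun enc_rexp :: "rexp \<Rightarrow> val" where
  "enc_rexp (Num i) = P (I 0) (I i)"
| "enc_rexp Boltz = P (I 1) (I 0)"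
| "enc_rexp (RAdd a b) = P (I 2) (P (enc_rexp a) (enc_rexp b))"
| "enc_rexp (RSub a b) = P (I 3) (P (enc_rexp a) (enc_rexp b))"
| "enc_rexp (RMul a b) = P (I 4) (P (enc_rexp a) (enc_rexp b))"
| "enc_rexp (RDiv a b) = P (I 5) (P (enc_rexp a) (enc_rexp b))"
| "enc_rexp (RExp a) = P (I 6) (enc_rexp a)"
| "enc_rexp (RLn a) = P (I 7) (enc_rexp a)"


section \<open>Strands, secondary structures and energy models\<close>

datatype base = Ade | Cyt | Gua | Thy

text \<open>A multiset of strands is given as a list, so that each base has a position
  (strand index, index within the strand).  A single strand is a one-element list.\<close>

type_synonym strands = "base list list"
type_synonym position = "nat \<times> nat"
type_synonym sec_structure = "position set set"

definition num_bases :: "strands \<Rightarrow> nat" where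
  "num_bases s = (\<Sum>w\<leftarrow>s. length w)"

definition positions :: "strands \<Rightarrow> position set" where
  "positions s = {(i, j). i < length s \<and> j < length (s ! i)}"

definition base_at :: "strands \<Rightarrow> position \<Rightarrow> base" where
  "base_at s p = s ! fst p ! snd p"

definition complementary :: "base \<Rightarrow> base \<Rightarrow> bool" where
  "complementary a b \<longleftrightarrow> (a, b) \<in> {(Ade, Thy), (Thy, Ade), (Cyt, Gua), (Gua, Cyt)}"

definition base_pairs :: "strands \<Rightarrow> position set set" where
  "base_pairs s =
     {{p, q} | p q. p \<in> positions s \<and> q \<in> positions s \<and> complementary (base_at s p) (base_at s q)}"

definition secondary_structures :: "strands \<Rightarrow> sec_structure set" where
  "secondary_structures s = {S. S \<subseteq> base_pairs s \<and> (\<forall>e\<in>S. \<forall>f\<in>S. e \<noteq> f \<longrightarrow> e \<inter> f = {})}"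

text \<open>\<open>M s S T\<close> is the free energy of the structure \<open>S\<close> of \<open>s\<close> at temperature \<open>T\<close>.\<close>

type_synonym energy_model = "strands \<Rightarrow> sec_structure \<Rightarrow> real \<Rightarrow> real"

definition magnify :: "real \<Rightarrow> energy_model \<Rightarrow> energy_model" where
  "magnify \<alpha> M = (\<lambda>s S T. \<alpha> * M s S T)"

definition PF :: "real \<Rightarrow> (strands \<Rightarrow> sec_structure set) \<Rightarrow> strands \<Rightarrow> real \<Rightarrow> energy_model \<Rightarrow> real" where
  "PF kB \<Omega> s T M = (\<Sum>S\<in>\<Omega> s. exp (- M s S T / (kB * T)))"

definition dPF ::
    "real \<Rightarrow> (strands \<Rightarrow> sec_structure set) \<Rightarrow> strands \<Rightarrow> real \<Rightarrow> energy_model \<Rightarrow> real \<Rightarrow> bool" where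
  "dPF kB \<Omega> s T M k \<longleftrightarrow> PF kB \<Omega> s T M \<ge> k"


section \<open>The computational problems\<close>

type_synonym pf_input = "strands \<times> rat \<times> energy_model"

fun enc_base :: "base \<Rightarrow> val" where
  "enc_base Ade = I 0"
| "enc_base Cyt = I 1"
| "enc_base Gua = I 2"
| "enc_base Thy = I 3"

fun enc_list :: "('a \<Rightarrow> val) \<Rightarrow> 'a list \<Rightarrow> val" where
  "enc_list f [] = I 0"
| "enc_list f (x # xs) = P (f x) (enc_list f xs)"

definition enc_rat :: "rat \<Rightarrow> val" where
  "enc_rat q = (case quotient_of q of (a, b) \<Rightarrow> P (I a) (I b))"

fun enc_input :: "(energy_model \<Rightarrow> val) \<Rightarrow> pf_input \<Rightarrow> val" where
  "enc_input enc_model (s, T, M) = P (enc_list (enc_list enc_base) s) (P (enc_rat T) (enc_model M))"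

fun PF_output :: "real \<Rightarrow> (strands \<Rightarrow> sec_structure set) \<Rightarrow> pf_input \<Rightarrow> val \<Rightarrow> bool" where
  "PF_output kB \<Omega> (s, T, M) v \<longleftrightarrow>
     (\<exists>e. v = enc_rexp e \<and> well_defined kB e \<and> reval kB e = PF kB \<Omega> s (of_rat T) M)"

text \<open>
  A query to the decision problem describes the magnified model by the original model and the
  factor.  Values that do not encode a query are answered negatively.
\<close>

definition dPF_magnified ::
    "real \<Rightarrow> (strands \<Rightarrow> sec_structure set) \<Rightarrow> pf_input set \<Rightarrow> (energy_model \<Rightarrow> val) \<Rightarrow> val set" where
  "dPF_magnified kB \<Omega> inputs enc_model =
     {P (enc_input enc_model (s, T, M)) (P (enc_rexp a) (enc_rexp k)) | s T M a k.
        (s, T, M) \<in> inputs \<and> well_defined kB a \<and> well_defined kB k \<and> reval kB a > 0 \<and>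
        dPF kB \<Omega> s (of_rat T) (magnify (reval kB a) M) (reval kB k)}"

text \<open>Precision: at most \<open>d = O(log n)\<close> digits after the decimal point.\<close>

definition candidate_levels ::
    "(strands \<Rightarrow> sec_structure set) \<Rightarrow> pf_input set \<Rightarrow> (energy_model \<Rightarrow> val) \<Rightarrow> (pf_input \<Rightarrow> rat set) \<Rightarrow> bool"
    where
  "candidate_levels \<Omega> inputs enc_model levels \<longleftrightarrow>
     (\<forall>(s, T, M)\<in>inputs. finite (levels (s, T, M)) \<and>
        (\<forall>S\<in>\<Omega> s. M s S (of_rat T) \<in> of_rat ` levels (s, T, M))) \<and>
     (\<exists>p :: nat poly. \<forall>(s, T, M)\<in>inputs. card (levels (s, T, M)) \<le> poly p (num_bases s)) \<and>
     polytime_solvable inputs (enc_input enc_model)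
       (\<lambda>x v. \<exists>gs. v = enc_list enc_rat gs \<and> set gs = levels x) \<and>
     (\<exists>C :: real. \<forall>(s, T, M)\<in>inputs. \<forall>g\<in>levels (s, T, M).
        \<exists>d :: nat. real d \<le> C * ln (real (num_bases s) + 2) \<and> 10 ^ d * g \<in> \<int>)"

end

theory Submission imports Defs begin

text \<open>
  Let \<open>L\<close> be a common denominator of the candidate levels and \<open>B > card (\<Omega> s)\<close> (here
  \<open>B = 2 * 2 ^ n\<^sup>2\<close>).  Magnifying the energies by \<open>\<alpha> = kB * T * L * ln B\<close> gives a structure of
  energy \<open>g\<close> the weight \<open>B powr (- L * g)\<close>, so that all structures above a level together weigh less
  than one structure at this level.  The magnified partition function is therefore a number in
  base \<open>B\<close> whose digits are the numbers \<open>N g\<close> of structures of energy \<open>g\<close>, and the oracle allows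
  these digits to be read off by binary search, from the lowest level upwards.  The partition
  function itself is \<open>\<Sum>g. N g * exp (- g / (kB * T))\<close>.

  The levels may come with repetitions and in any order.  Each round selects the least level above
  the previous one; an integer larger than all levels serves as a dummy level of multiplicity 0 once
  the levels are exhausted, so that exactly as many rounds as there are list entries can be run.
\<close>

section \<open>Bit sizes and costs\<close>

lemma vsize_ge_1: "1 \<le> vsize v"
  by (cases v) auto

lemma vsize_int_bound: "\<bar>i\<bar> < 2 ^ k \<Longrightarrow> vsize (I i) \<le> 1 + k"
  by (auto intro!: floorlog_leI simp: nat_less_iff)

lemma int_bound_vsize: "\<bar>i\<bar> < 2 ^ (vsize (I i) - 1)"
proof (cases "i = 0")
  case False
  then have "nat \<bar>i\<bar> < 2 ^ floorlog 2 (nat \<bar>i\<bar>)"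
    by (intro floorlog_bounds[THEN conjunct2]) auto
  then show ?thesis by (simp add: nat_less_iff)
qed simp

lemma vsize_mult: "vsize (I (a * b)) \<le> vsize (I a) + vsize (I b)"
proof -
  let ?m = "vsize (I a) - 1" and ?n = "vsize (I b) - 1"
  have "\<bar>a * b\<bar> < 2 ^ ?m * 2 ^ ?n"
    unfolding abs_mult using int_bound_vsize[of a] int_bound_vsize[of b]
    by (intro mult_strict_mono) (auto simp del: vsize.simps)
  then have "vsize (I (a * b)) \<le> 1 + (?m + ?n)"
    by (intro vsize_int_bound) (simp add: power_add)
  then show ?thesis by simp
qed

lemma vsize_add: "vsize (I (a + b)) \<le> vsize (I a) + vsize (I b)"
proof -
  let ?m = "vsize (I a) - 1" and ?n = "vsize (I b) - 1"
  have p: "(1::int) \<le> 2 ^ ?m" "(1::int) \<le> 2 ^ ?n" by (auto simp del: vsize.simps)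
  have "0 \<le> (2 ^ ?m - 1) * ((2::int) ^ ?n - 1)"
    using p by (intro mult_nonneg_nonneg) (auto simp del: vsize.simps)
  then have "(2::int) ^ ?m + 2 ^ ?n \<le> 2 ^ (1 + (?m + ?n))"
    using p mult_mono[OF p] by (simp add: power_add algebra_simps del: vsize.simps)
  moreover have "\<bar>a + b\<bar> < 2 ^ ?m + 2 ^ ?n"
    using int_bound_vsize[of a] int_bound_vsize[of b] by linarith
  ultimately have "vsize (I (a + b)) \<le> 1 + (1 + (?m + ?n))"
    by (intro vsize_int_bound) linarith
  then show ?thesis by simp
qed

lemma vsize_uminus: "vsize (I (- a)) = vsize (I a)"
  by simp

lemma vsize_diff: "vsize (I (a - b)) \<le> vsize (I a) + vsize (I b)"
  using vsize_add[of a "- b"] by simp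

lemma abs_div_le: "\<bar>a div b\<bar> \<le> \<bar>a\<bar>" for a b :: int
proof (cases "b = 0")
  case False
  have "\<bar>a div b\<bar> \<le> \<bar>a\<bar>" if "b > 0" for a b :: int
  proof (cases "a \<ge> 0")
    case True
    moreover have "a div b \<le> a div 1" using True that by (intro zdiv_mono2) auto
    ultimately show ?thesis using that by (simp add: pos_imp_zdiv_nonneg_iff)
  next
    case f: False
    have "a \<le> a div b"
    proof -
      have "a * b \<le> a" using f that mult_left_mono_neg[of 1 b a] by simp
      then show ?thesis using that zdiv_mono1[of "a * b" a b] by simp
    qed
    moreover have "a div b < 0" using f that pos_imp_zdiv_neg_iff[of b a] by simp
    ultimately show ?thesis by simp
  qed
  from this[of b a] this[of "- b" "- a"] False show ?thesis
    by (cases "b > 0") (auto simp: div_minus_minus)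
qed simp

lemma vsize_div: "vsize (I (a div b)) \<le> vsize (I a)"
  using abs_div_le[of a b] by (auto intro!: floorlog_mono nat_mono)

lemma vsize_as_int: "vsize (I (as_int v)) \<le> vsize v"
  by (cases v) (auto simp: floorlog_def)

lemma vsize_left: "vsize (left v) \<le> vsize v"
  by (cases v) (auto simp: floorlog_def)

lemma vsize_right: "vsize (right v) \<le> vsize v"
  by (cases v) (auto simp: floorlog_def)

lemma vsize_truth: "vsize (truth b) \<le> 2"
  by (auto simp: truth_def floorlog_def)

lemma vsize_peval_le_pcost: "vsize (peval e s) \<le> pcost e s"
  by (subst pcost.simps) simp

definition bounded_state :: "state \<Rightarrow> nat \<Rightarrow> bool" where
  "bounded_state s K \<longleftrightarrow> (\<forall>x. vsize (s x) \<le> K)"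

lemma bounded_state_pos: "bounded_state s K \<Longrightarrow> 1 \<le> K"
  unfolding bounded_state_def using vsize_ge_1 le_trans by blast

lemma bounded_state_mono: "bounded_state s K \<Longrightarrow> K \<le> K' \<Longrightarrow> bounded_state s K'"
  unfolding bounded_state_def using le_trans by blast

fun exp_factor :: "pexp \<Rightarrow> nat" where
  "exp_factor (Var x) = 1"
| "exp_factor (Const i) = vsize (I i)"
| "exp_factor (Left a) = 2 * exp_factor a"
| "exp_factor (Right a) = 2 * exp_factor a"
| "exp_factor (IsPair a) = 2 + exp_factor a"
| "exp_factor (MkPair a b) = 1 + 2 * (exp_factor a + exp_factor b)"
| "exp_factor (Add a b) = 2 * (exp_factor a + exp_factor b)"
| "exp_factor (Sub a b) = 2 * (exp_factor a + exp_factor b)"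
| "exp_factor (Mul a b) = 2 * (exp_factor a + exp_factor b)"
| "exp_factor (Div a b) = 2 * (exp_factor a + exp_factor b)"
| "exp_factor (Less a b) = 2 + exp_factor a + exp_factor b"

lemma pcost_le_factor:
  assumes "bounded_state s K"
  shows "pcost e s \<le> exp_factor e * K"
proof -
  have K: "1 \<le> K" using assms by (rule bounded_state_pos)
  show ?thesis
  proof (induction e)
    case (Var x)
    then show ?case using assms by (subst pcost.simps) (simp add: bounded_state_def)
  next
    case (Const i)
    then show ?case using K mult_le_mono2[OF K, of "vsize (I i)"]
      by (subst pcost.simps) (simp del: vsize.simps)
  next
    case (MkPair a b)
    then show ?case using K vsize_peval_le_pcost[of a s] vsize_peval_le_pcost[of b s]
      by (subst pcost.simps) (simp add: algebra_simps)
  next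
    case (Left a)
    then show ?case using vsize_peval_le_pcost[of a s] vsize_left[of "peval a s"]
      by (subst pcost.simps) simp
  next
    case (Right a)
    then show ?case using vsize_peval_le_pcost[of a s] vsize_right[of "peval a s"]
      by (subst pcost.simps) simp
  next
    case (IsPair a)
    then show ?case using K vsize_truth[of "is_pair (peval a s)"]
      by (subst pcost.simps) (simp add: algebra_simps)
  next
    case (Add a b)
    then show ?case
      using vsize_add[of "as_int (peval a s)" "as_int (peval b s)"] vsize_as_int[of "peval a s"]
        vsize_as_int[of "peval b s"] vsize_peval_le_pcost[of a s] vsize_peval_le_pcost[of b s]
      by (subst pcost.simps) (simp add: algebra_simps del: vsize.simps)
  next
    case (Sub a b)
    then show ?case
      using vsize_diff[of "as_int (peval a s)" "as_int (peval b s)"] vsize_as_int[of "peval a s"]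
        vsize_as_int[of "peval b s"] vsize_peval_le_pcost[of a s] vsize_peval_le_pcost[of b s]
      by (subst pcost.simps) (simp add: algebra_simps del: vsize.simps)
  next
    case (Mul a b)
    then show ?case
      using vsize_mult[of "as_int (peval a s)" "as_int (peval b s)"] vsize_as_int[of "peval a s"]
        vsize_as_int[of "peval b s"] vsize_peval_le_pcost[of a s] vsize_peval_le_pcost[of b s]
      by (subst pcost.simps) (simp add: algebra_simps del: vsize.simps)
  next
    case (Div a b)
    then show ?case
      using vsize_div[of "as_int (peval a s)" "as_int (peval b s)"] vsize_as_int[of "peval a s"]
        vsize_as_int[of "peval b s"] vsize_peval_le_pcost[of a s] vsize_peval_le_pcost[of b s]
      by (subst pcost.simps) (simp add: algebra_simps del: vsize.simps)
  next
    case (Less a b)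
    then show ?case using K vsize_truth[of "as_int (peval a s) < as_int (peval b s)"]
      by (subst pcost.simps) (simp add: algebra_simps)
  qed
qed

lemma exec_bounded_state:
  "exec Q c s n t \<Longrightarrow> bounded_state s K \<Longrightarrow> bounded_state t (K + n)"
proof (induction arbitrary: K rule: exec.induct)
  case (Assign x e s)
  have "vsize (s y) \<le> K + (1 + pcost e s)" for y
    using Assign trans_le_add1 unfolding bounded_state_def by blast
  then show ?case using vsize_peval_le_pcost[of e s] by (auto simp: bounded_state_def)
next
  case (Seq c s m u d n t)
  from Seq.IH(2)[OF Seq.IH(1)[OF Seq.prems]] show ?case by (rule bounded_state_mono) simp
next
  case (CondTrue e s c n t d)
  from CondTrue.IH[OF CondTrue.prems] show ?case by (rule bounded_state_mono) simp
next
  case (CondFalse e s d n t c)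
  from CondFalse.IH[OF CondFalse.prems] show ?case by (rule bounded_state_mono) simp
next
  case (WhileTrue e s c m u n t)
  from WhileTrue.IH(2)[OF WhileTrue.IH(1)[OF WhileTrue.prems]] show ?case
    by (rule bounded_state_mono) simp
next
  case (Ask x e s)
  have "vsize (truth (peval e s \<in> Q)) \<le> K + (1 + pcost e s)"
    using vsize_truth[of "peval e s \<in> Q"] bounded_state_pos[OF Ask]
      vsize_peval_le_pcost[of e s] vsize_ge_1[of "peval e s"] by linarith
  moreover have "vsize (s y) \<le> K + (1 + pcost e s)" for y
    using Ask trans_le_add1 unfolding bounded_state_def by blast
  ultimately show ?case by (auto simp: bounded_state_def)
qed (auto elim: bounded_state_mono)

fun writes :: "com \<Rightarrow> nat set" where
  "writes Skip = {}"
| "writes (Assign x e) = {x}"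
| "writes (Seq c d) = writes c \<union> writes d"
| "writes (Cond e c d) = writes c \<union> writes d"
| "writes (While e c) = writes c"
| "writes (Ask x e) = {x}"

lemma exec_unchanged: "exec Q c s n t \<Longrightarrow> y \<notin> writes c \<Longrightarrow> t y = s y"
  by (induction rule: exec.induct) auto

section \<open>Renaming of variables\<close>

fun rename_exp :: "(nat \<Rightarrow> nat) \<Rightarrow> pexp \<Rightarrow> pexp" where
  "rename_exp f (Var x) = Var (f x)"
| "rename_exp f (Const i) = Const i"
| "rename_exp f (MkPair a b) = MkPair (rename_exp f a) (rename_exp f b)"
| "rename_exp f (Left a) = Left (rename_exp f a)"
| "rename_exp f (Right a) = Right (rename_exp f a)"
| "rename_exp f (IsPair a) = IsPair (rename_exp f a)"
| "rename_exp f (Add a b) = Add (rename_exp f a) (rename_exp f b)"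
| "rename_exp f (Sub a b) = Sub (rename_exp f a) (rename_exp f b)"
| "rename_exp f (Mul a b) = Mul (rename_exp f a) (rename_exp f b)"
| "rename_exp f (Div a b) = Div (rename_exp f a) (rename_exp f b)"
| "rename_exp f (Less a b) = Less (rename_exp f a) (rename_exp f b)"

fun rename :: "(nat \<Rightarrow> nat) \<Rightarrow> com \<Rightarrow> com" where
  "rename f Skip = Skip"
| "rename f (Assign x e) = Assign (f x) (rename_exp f e)"
| "rename f (Seq c d) = Seq (rename f c) (rename f d)"
| "rename f (Cond e c d) = Cond (rename_exp f e) (rename f c) (rename f d)"
| "rename f (While e c) = While (rename_exp f e) (rename f c)"
| "rename f (Ask x e) = Ask (f x) (rename_exp f e)"

lemma peval_rename: "peval (rename_exp f e) s = peval e (s \<circ> f)"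
  by (induction e) auto

lemma pcost_rename: "pcost (rename_exp f e) s = pcost e (s \<circ> f)"
proof (induction e)
qed (subst pcost.simps, subst pcost.simps[of _ "s \<circ> f"], simp add: peval_rename o_def)+

lemma writes_rename: "writes (rename f c) = f ` writes c"
  by (induction c) auto

lemma fun_upd_comp_inj: "inj f \<Longrightarrow> s(f x := v) \<circ> f = (s \<circ> f)(x := v)"
  by (auto simp: fun_eq_iff inj_eq)

lemma exec_rename:
  assumes "inj f"
  shows "exec {} c s n t \<Longrightarrow> oracle_free c \<Longrightarrow> s' \<circ> f = s \<Longrightarrow>
    \<exists>t'. exec Q (rename f c) s' n t' \<and> t' \<circ> f = t"
proof (induction arbitrary: s' rule: exec.induct)
  case (Skip s)
  then show ?case using exec.Skip[of Q s'] by auto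
next
  case (Assign x e s)
  have "exec Q (rename f (Assign x e)) s' (1 + pcost e s) (s'(f x := peval e s))"
    using exec.Assign[of Q "f x" "rename_exp f e" s']
    unfolding pcost_rename peval_rename rename.simps Assign(2) .
  moreover have "s'(f x := peval e s) \<circ> f = s(x := peval e s)"
    unfolding fun_upd_comp_inj[OF assms] Assign ..
  ultimately show ?case by blast
next
  case (Seq c s m u d n t)
  have "oracle_free c" "oracle_free d" using Seq.prems by simp_all
  from Seq.IH(1)[OF this(1) Seq.prems(2)] obtain u' where
    u': "exec Q (rename f c) s' m u'" "u' \<circ> f = u" by blast
  from Seq.IH(2)[OF \<open>oracle_free d\<close> u'(2)] obtain t' where
    t': "exec Q (rename f d) u' n t'" "t' \<circ> f = t" by blast
  then show ?case using exec.Seq[OF u'(1) t'(1)] unfolding rename.simps by blast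
next
  case (CondTrue e s c n t d)
  then have "oracle_free c" by simp
  from CondTrue.IH[OF this CondTrue.prems(2)] obtain t' where
    t': "exec Q (rename f c) s' n t'" "t' \<circ> f = t" by blast
  have "exec Q (rename f (Cond e c d)) s' (1 + pcost e s + n) t'"
    using exec.CondTrue[of "rename_exp f e" s' Q "rename f c" n t' "rename f d"] CondTrue.hyps t'
    unfolding pcost_rename peval_rename rename.simps CondTrue.prems(2) by blast
  then show ?case using t' by blast
next
  case (CondFalse e s d n t c)
  then have "oracle_free d" by simp
  from CondFalse.IH[OF this CondFalse.prems(2)] obtain t' where
    t': "exec Q (rename f d) s' n t'" "t' \<circ> f = t" by blast
  have "exec Q (rename f (Cond e c d)) s' (1 + pcost e s + n) t'"
    using exec.CondFalse[of "rename_exp f e" s' Q "rename f d" n t' "rename f c"] CondFalse.hyps t'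
    unfolding pcost_rename peval_rename rename.simps CondFalse.prems(2) by blast
  then show ?case using t' by blast
next
  case (WhileFalse e s c)
  have "exec Q (rename f (While e c)) s' (1 + pcost e s) s'"
    using exec.WhileFalse[of "rename_exp f e" s' Q "rename f c"] WhileFalse.hyps
    unfolding pcost_rename peval_rename rename.simps WhileFalse.prems(2) by blast
  then show ?case using WhileFalse by blast
next
  case (WhileTrue e s c m u n t)
  have "oracle_free c" using WhileTrue.prems by simp
  from WhileTrue.IH(1)[OF this WhileTrue.prems(2)] obtain u' where
    u': "exec Q (rename f c) s' m u'" "u' \<circ> f = u" by blast
  from WhileTrue.IH(2)[OF WhileTrue.prems(1) u'(2)] obtain t' where
    t': "exec Q (rename f (While e c)) u' n t'" "t' \<circ> f = t" by blast
  have "exec Q (rename f (While e c)) s' (1 + pcost e s + m + n) t'"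
    using exec.WhileTrue[of "rename_exp f e" s' Q "rename f c" m u' n t'] WhileTrue.hyps
      u' t' unfolding pcost_rename peval_rename rename.simps WhileTrue.prems(2) by blast
  then show ?case using t' by blast
qed simp

section \<open>Polynomial-time triples\<close>

definition poly_bounded :: "(nat \<Rightarrow> nat) \<Rightarrow> bool" where
  "poly_bounded f \<longleftrightarrow> (\<exists>p. \<forall>k. f k \<le> poly p k)"

lemma poly_nat_mono: "a \<le> b \<Longrightarrow> poly p a \<le> poly p b" for p :: "nat poly"
  by (induction p) (auto intro: mult_le_mono)

lemma poly_bounded_poly: "poly_bounded (poly p)"
  unfolding poly_bounded_def by blast

lemma poly_bounded_const: "poly_bounded (\<lambda>_. c)"
  unfolding poly_bounded_def by (rule exI[of _ "[:c:]"]) simp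

lemma poly_bounded_id: "poly_bounded (\<lambda>k. k)"
  unfolding poly_bounded_def by (rule exI[of _ "[:0, 1:]"]) simp

lemma poly_bounded_add: "poly_bounded f \<Longrightarrow> poly_bounded g \<Longrightarrow> poly_bounded (\<lambda>k. f k + g k)"
proof -
  assume "poly_bounded f" "poly_bounded g"
  then obtain p q where "\<And>k. f k \<le> poly p k" "\<And>k. g k \<le> poly q k"
    unfolding poly_bounded_def by blast
  then have "f k + g k \<le> poly (p + q) k" for k by (simp add: add_mono)
  then show ?thesis unfolding poly_bounded_def by blast
qed

lemma poly_bounded_mult: "poly_bounded f \<Longrightarrow> poly_bounded g \<Longrightarrow> poly_bounded (\<lambda>k. f k * g k)"
proof -
  assume "poly_bounded f" "poly_bounded g"
  then obtain p q where "\<And>k. f k \<le> poly p k" "\<And>k. g k \<le> poly q k"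
    unfolding poly_bounded_def by blast
  then have "f k * g k \<le> poly (p * q) k" for k by (simp add: mult_le_mono)
  then show ?thesis unfolding poly_bounded_def by blast
qed

lemma poly_bounded_compose:
  assumes "poly_bounded f" "poly_bounded g"
  shows "poly_bounded (\<lambda>k. f (g k))"
proof -
  from assms obtain p q where pq: "\<And>k. f k \<le> poly p k" "\<And>k. g k \<le> poly q k"
    unfolding poly_bounded_def by blast
  have "f (g k) \<le> poly (pcompose p q) k" for k
    using pq(1)[of "g k"] poly_nat_mono[OF pq(2)[of k], of p] by (simp add: poly_pcompose)
  then show ?thesis unfolding poly_bounded_def by blast
qed

lemmas poly_bounded_intros =
  poly_bounded_const poly_bounded_id poly_bounded_add poly_bounded_mult

definition ptriple ::
    "val set \<Rightarrow> 'i set \<Rightarrow> ('i \<Rightarrow> state \<Rightarrow> bool) \<Rightarrow> com \<Rightarrow> ('i \<Rightarrow> state \<Rightarrow> bool) \<Rightarrow> bool" where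
  "ptriple Q D A c B \<longleftrightarrow> (\<exists>f. poly_bounded f \<and>
     (\<forall>i\<in>D. \<forall>s K. bounded_state s K \<longrightarrow> A i s \<longrightarrow>
        (\<exists>n t. exec Q c s n t \<and> n \<le> f K \<and> B i t)))"

lemma ptripleI:
  assumes "poly_bounded f"
    and "\<And>i s K. i \<in> D \<Longrightarrow> bounded_state s K \<Longrightarrow> A i s \<Longrightarrow> \<exists>n t. exec Q c s n t \<and> n \<le> f K \<and> B i t"
  shows "ptriple Q D A c B"
  unfolding ptriple_def using assms by blast

lemma ptriple_apply:
  assumes "ptriple Q D A c B"
    and "\<And>i s. i \<in> D' \<Longrightarrow> A' i s \<Longrightarrow>
      \<exists>j\<in>D. A j s \<and> (\<forall>t. B j t \<longrightarrow> (\<forall>y. y \<notin> writes c \<longrightarrow> t y = s y) \<longrightarrow> B' i t)"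
  shows "ptriple Q D' A' c B'"
proof -
  from assms(1) obtain f where f: "poly_bounded f"
    "\<And>i s K. i \<in> D \<Longrightarrow> bounded_state s K \<Longrightarrow> A i s \<Longrightarrow> \<exists>n t. exec Q c s n t \<and> n \<le> f K \<and> B i t"
    unfolding ptriple_def by blast
  show ?thesis
  proof (rule ptripleI[OF f(1)])
    fix i s K assume i: "i \<in> D'" and s: "bounded_state s K" and A: "A' i s"
    from assms(2)[OF i A] obtain j where j: "j \<in> D" "A j s"
      "\<And>t. B j t \<Longrightarrow> (\<And>y. y \<notin> writes c \<Longrightarrow> t y = s y) \<Longrightarrow> B' i t" by blast
    from f(2)[OF j(1) s j(2)] obtain n t where t: "exec Q c s n t" "n \<le> f K" "B j t" by blast
    with j(3)[OF t(3) exec_unchanged[OF t(1)]]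
    show "\<exists>n t. exec Q c s n t \<and> n \<le> f K \<and> B' i t" by blast
  qed
qed

lemma ptriple_seq:
  assumes "ptriple Q D A c B" and "ptriple Q D B d C"
  shows "ptriple Q D A (Seq c d) C"
proof -
  from assms(1) obtain f where f: "poly_bounded f"
    "\<And>i s K. i \<in> D \<Longrightarrow> bounded_state s K \<Longrightarrow> A i s \<Longrightarrow> \<exists>n t. exec Q c s n t \<and> n \<le> f K \<and> B i t"
    unfolding ptriple_def by blast
  from assms(2) obtain g where g: "poly_bounded g"
    "\<And>i s K. i \<in> D \<Longrightarrow> bounded_state s K \<Longrightarrow> B i s \<Longrightarrow> \<exists>n t. exec Q d s n t \<and> n \<le> g K \<and> C i t"
    unfolding ptriple_def by blast
  show ?thesis
  proof (rule ptripleI[where f = "\<lambda>K. 1 + f K + g (K + f K)"])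
    show "poly_bounded (\<lambda>K. 1 + f K + g (K + f K))"
      by (intro poly_bounded_intros poly_bounded_compose[OF g(1)] f(1))
    fix i s K assume i: "i \<in> D" and s: "bounded_state s K" and A: "A i s"
    from f(2)[OF i s A] obtain m u where u: "exec Q c s m u" "m \<le> f K" "B i u" by blast
    have "bounded_state u (K + f K)"
      by (rule bounded_state_mono[OF exec_bounded_state[OF u(1) s]]) (use u(2) in simp)
    from g(2)[OF i this u(3)] obtain n t where t: "exec Q d u n t" "n \<le> g (K + f K)" "C i t"
      by blast
    have "exec Q (Seq c d) s (1 + m + n) t" using u t by (blast intro: exec.Seq)
    moreover have "1 + m + n \<le> 1 + f K + g (K + f K)" using u t by simp
    ultimately show "\<exists>n t. exec Q (Seq c d) s n t \<and> n \<le> 1 + f K + g (K + f K) \<and> C i t"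
      using t(3) by blast
  qed
qed

fun loop_free :: "com \<Rightarrow> bool" where
  "loop_free (While e c) = False"
| "loop_free (Seq c d) = (loop_free c \<and> loop_free d)"
| "loop_free (Cond e c d) = (loop_free c \<and> loop_free d)"
| "loop_free _ = True"

fun run :: "val set \<Rightarrow> com \<Rightarrow> state \<Rightarrow> state" where
  "run Q (Assign x e) s = s(x := peval e s)"
| "run Q (Seq c d) s = run Q d (run Q c s)"
| "run Q (Cond e c d) s = (if peval e s \<noteq> I 0 then run Q c s else run Q d s)"
| "run Q (Ask x e) s = s(x := truth (peval e s \<in> Q))"
| "run Q _ s = s"

lemma ptriple_run:
  "loop_free c \<Longrightarrow> ptriple Q UNIV (\<lambda>u s. s = u) c (\<lambda>u t. t = run Q c u)"
proof (induction c)
  case Skip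
  show ?case
    by (rule ptripleI[OF poly_bounded_const[of 1]]) (use exec.Skip[of Q] in auto)
next
  case (Assign x e)
  show ?case
  proof (rule ptripleI[where f = "\<lambda>K. 1 + exp_factor e * K"])
    show "poly_bounded (\<lambda>K. 1 + exp_factor e * K)" by (intro poly_bounded_intros)
    fix u s :: state and K assume "bounded_state s K" "s = u"
    with exec.Assign[of Q x e s] pcost_le_factor[of s K e]
    show "\<exists>n t. exec Q (Assign x e) s n t \<and> n \<le> 1 + exp_factor e * K \<and> t = run Q (Assign x e) u"
      by (intro exI[of _ "1 + pcost e s"]) simp
  qed
next
  case (Ask x e)
  show ?case
  proof (rule ptripleI[where f = "\<lambda>K. 1 + exp_factor e * K"])
    show "poly_bounded (\<lambda>K. 1 + exp_factor e * K)" by (intro poly_bounded_intros)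
    fix u s :: state and K assume "bounded_state s K" "s = u"
    with exec.Ask[of Q x e s] pcost_le_factor[of s K e]
    show "\<exists>n t. exec Q (Ask x e) s n t \<and> n \<le> 1 + exp_factor e * K \<and> t = run Q (Ask x e) u"
      by (intro exI[of _ "1 + pcost e s"]) simp
  qed
next
  case (Seq c d)
  then have c: "ptriple Q UNIV (\<lambda>u s. s = u) c (\<lambda>u t. t = run Q c u)"
    and d: "ptriple Q UNIV (\<lambda>u s. s = u) d (\<lambda>u t. t = run Q d u)" by simp_all
  have "ptriple Q UNIV (\<lambda>u s. s = run Q c u) d (\<lambda>u t. t = run Q (Seq c d) u)"
    by (rule ptriple_apply[OF d]) simp
  from ptriple_seq[OF c this] show ?case .
next
  case (Cond e c d)
  then have "ptriple Q UNIV (\<lambda>u s. s = u) c (\<lambda>u t. t = run Q c u)"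
    "ptriple Q UNIV (\<lambda>u s. s = u) d (\<lambda>u t. t = run Q d u)" by simp_all
  then obtain f g where fg: "poly_bounded f" "poly_bounded g"
    "\<And>s K. bounded_state s K \<Longrightarrow> \<exists>n. exec Q c s n (run Q c s) \<and> n \<le> f K"
    "\<And>s K. bounded_state s K \<Longrightarrow> \<exists>n. exec Q d s n (run Q d s) \<and> n \<le> g K"
    unfolding ptriple_def by blast
  show ?case
  proof (rule ptripleI[where f = "\<lambda>K. 1 + exp_factor e * K + (f K + g K)"])
    show "poly_bounded (\<lambda>K. 1 + exp_factor e * K + (f K + g K))"
      by (intro poly_bounded_intros fg)
    fix u s :: state and K assume s: "bounded_state s K" "s = u"
    from fg(3)[OF s(1)] obtain m where m: "exec Q c s m (run Q c s)" "m \<le> f K" by blast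
    from fg(4)[OF s(1)] obtain n where n: "exec Q d s n (run Q d s)" "n \<le> g K" by blast
    have p: "pcost e s \<le> exp_factor e * K" using s(1) by (rule pcost_le_factor)
    show "\<exists>n t. exec Q (Cond e c d) s n t \<and> n \<le> 1 + exp_factor e * K + (f K + g K) \<and>
      t = run Q (Cond e c d) u"
    proof (cases "peval e s = I 0")
      case True
      show ?thesis
        using exec.CondFalse[OF True n(1), of c] True n(2) p s(2)
        by (intro exI[of _ "1 + pcost e s + n"] exI[of _ "run Q d s"]) simp
    next
      case False
      show ?thesis
        using exec.CondTrue[OF False m(1), of d] False m(2) p s(2)
        by (intro exI[of _ "1 + pcost e s + m"] exI[of _ "run Q c s"]) simp
    qed
  qed
qed simp

lemma ptriple_straight:
  assumes "loop_free c" and "\<And>i s. i \<in> D \<Longrightarrow> A i s \<Longrightarrow> B i (run Q c s)"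
  shows "ptriple Q D A c B"
proof -
  from ptriple_run[OF assms(1), of Q] obtain f where "poly_bounded f"
    "\<And>s K. bounded_state s K \<Longrightarrow> \<exists>n. exec Q c s n (run Q c s) \<and> n \<le> f K"
    unfolding ptriple_def by blast
  then show ?thesis using assms(2) by (intro ptripleI[of f]) blast+
qed

lemma ptriple_pre:
  assumes "ptriple Q D A c B" and "\<And>i s. i \<in> D \<Longrightarrow> A' i s \<Longrightarrow> A i s"
  shows "ptriple Q D A' c B"
  by (rule ptriple_apply[OF assms(1)]) (use assms(2) in blast)

lemma ptriple_straight_seq:
  assumes "ptriple Q D B d C" and "loop_free c"
  shows "ptriple Q D (\<lambda>i s. B i (run Q c s)) (Seq c d) C"
  by (rule ptriple_seq[OF ptriple_straight[OF assms(2)] assms(1)])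

text \<open>The ghost parameter \<open>K\<close> of the invariant is a bound on the size of the state in which the loop
  is entered; it allows the invariant to speak about the growth of values during the loop.\<close>

lemma ptriple_while:
  assumes g: "poly_bounded g"
    and init: "\<And>i s K. i \<in> D \<Longrightarrow> bounded_state s K \<Longrightarrow> A i s \<Longrightarrow> Inv i K s"
    and size: "\<And>i s K y. i \<in> D \<Longrightarrow> Inv i K s \<Longrightarrow> (\<And>y. y \<notin> writes c \<Longrightarrow> vsize (s y) \<le> K) \<Longrightarrow>
      y \<in> writes c \<Longrightarrow> vsize (s y) \<le> g K"
    and body: "ptriple Q (D \<times> UNIV)
      (\<lambda>(i, K, m) s. Inv i K s \<and> peval e s \<noteq> I 0 \<and> vsize (s v) = m) c
      (\<lambda>(i, K, m) t. Inv i K t \<and> vsize (t v) < m)"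
    and post: "\<And>i K t. i \<in> D \<Longrightarrow> Inv i K t \<Longrightarrow> peval e t = I 0 \<Longrightarrow> B i t"
  shows "ptriple Q D A (While e c) B"
proof -
  from body obtain f where f1: "poly_bounded f" and
    f0: "\<forall>j\<in>D \<times> UNIV. \<forall>s K. bounded_state s K \<longrightarrow>
      (case j of (i, K, m) \<Rightarrow> \<lambda>s. Inv i K s \<and> peval e s \<noteq> I 0 \<and> vsize (s v) = m) s \<longrightarrow>
      (\<exists>n t. exec Q c s n t \<and> n \<le> f K \<and>
        (case j of (i, K, m) \<Rightarrow> \<lambda>t. Inv i K t \<and> vsize (t v) < m) t)"
    unfolding ptriple_def by (elim exE conjE)
  have f2: "\<exists>n t. exec Q c s n t \<and> n \<le> f K' \<and> Inv i K t \<and> vsize (t v) < vsize (s v)"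
    if "i \<in> D" "bounded_state s K'" "Inv i K s" "peval e s \<noteq> I 0" for i s K K'
    using f0[THEN bspec, of "(i, K, vsize (s v))"] that by simp
  define G where "G K = K + g K" for K
  define h where "h K = 1 + exp_factor e * G K + f (G K)" for K
  have pG: "poly_bounded G" unfolding G_def by (intro poly_bounded_intros g)
  have ph: "poly_bounded h"
    unfolding h_def by (intro poly_bounded_intros poly_bounded_compose[OF f1] pG)
  have loop: "\<exists>n t. exec Q (While e c) s n t \<and> n \<le> (vsize (s v) + 1) * h K \<and> Inv i K t \<and> peval e t = I 0"
    if i: "i \<in> D" and "Inv i K s" and "\<And>y. y \<notin> writes c \<Longrightarrow> vsize (s y) \<le> K" for i s K
    using that(2,3)
  proof (induction "vsize (s v)" arbitrary: s rule: less_induct)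
    case less
    have bs: "bounded_state s (G K)"
      unfolding bounded_state_def G_def
    proof
      fix y show "vsize (s y) \<le> K + g K"
        using less.prems(2)[of y] size[OF i less.prems, of y] by (cases "y \<in> writes c") auto
    qed
    have p: "1 + pcost e s \<le> 1 + exp_factor e * G K" using pcost_le_factor[OF bs] by simp
    show ?case
    proof (cases "peval e s = I 0")
      case True
      have "1 + pcost e s \<le> 1 * h K" using p h_def[of K] by linarith
      also have "\<dots> \<le> (vsize (s v) + 1) * h K" by (intro mult_le_mono1) simp
      finally show ?thesis using exec.WhileFalse[OF True, of Q c] True less.prems(1) by blast
    next
      case False
      from f2[OF i bs less.prems(1) False] obtain m u where
        u: "exec Q c s m u" "m \<le> f (G K)" "Inv i K u" "vsize (u v) < vsize (s v)" by blast
      have "vsize (u y) \<le> K" if "y \<notin> writes c" for y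
        using exec_unchanged[OF u(1) that] less.prems(2)[OF that] by simp
      from less.hyps[OF u(4) u(3) this] obtain n t where
        t: "exec Q (While e c) u n t" "n \<le> (vsize (u v) + 1) * h K" "Inv i K t" "peval e t = I 0"
        by blast
      have "1 + pcost e s + m + n \<le> h K + (vsize (u v) + 1) * h K"
        using p u(2) t(2) h_def[of K] by linarith
      also have "\<dots> = (vsize (u v) + 2) * h K" by simp
      also have "\<dots> \<le> (vsize (s v) + 1) * h K" using u(4) by (intro mult_le_mono1) simp
      finally show ?thesis using exec.WhileTrue[OF False u(1) t(1)] t by blast
    qed
  qed
  show ?thesis
  proof (rule ptripleI[where f = "\<lambda>K. (K + 1) * h K"])
    show "poly_bounded (\<lambda>K. (K + 1) * h K)" by (intro poly_bounded_intros ph)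
    fix i s K assume i: "i \<in> D" and s: "bounded_state s K" and A: "A i s"
    have "vsize (s y) \<le> K" for y using s unfolding bounded_state_def by blast
    from loop[OF i init[OF i s A] this] obtain n t where
      t: "exec Q (While e c) s n t" "n \<le> (vsize (s v) + 1) * h K" "Inv i K t" "peval e t = I 0"
      by blast
    have "(vsize (s v) + 1) * h K \<le> (K + 1) * h K"
      using \<open>vsize (s v) \<le> K\<close> by (intro mult_le_mono1) simp
    then show "\<exists>n t. exec Q (While e c) s n t \<and> n \<le> (K + 1) * h K \<and> B i t"
      using t(1) le_trans[OF t(2)] post[OF i t(3,4)] by blast
  qed
qed

lemma ptriple_while_straight:
  assumes "loop_free c" and "poly_bounded g"
    and "\<And>i s K. i \<in> D \<Longrightarrow> bounded_state s K \<Longrightarrow> A i s \<Longrightarrow> Inv i K s"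
    and "\<And>i s K y. i \<in> D \<Longrightarrow> Inv i K s \<Longrightarrow> (\<And>y. y \<notin> writes c \<Longrightarrow> vsize (s y) \<le> K) \<Longrightarrow>
      y \<in> writes c \<Longrightarrow> vsize (s y) \<le> g K"
    and "\<And>i s K. i \<in> D \<Longrightarrow> Inv i K s \<Longrightarrow> peval e s \<noteq> I 0 \<Longrightarrow>
      Inv i K (run Q c s) \<and> vsize (run Q c s v) < vsize (s v)"
    and "\<And>i K t. i \<in> D \<Longrightarrow> Inv i K t \<Longrightarrow> peval e t = I 0 \<Longrightarrow> B i t"
  shows "ptriple Q D A (While e c) B"
proof (rule ptriple_while[where Inv = Inv and g = g and v = v])
  show "ptriple Q (D \<times> UNIV)
     (\<lambda>(i, K, m) s. Inv i K s \<and> peval e s \<noteq> I 0 \<and> vsize (s v) = m) c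
     (\<lambda>(i, K, m) t. Inv i K t \<and> vsize (t v) < m)"
    by (rule ptriple_straight[OF assms(1)]) (use assms(5) in auto)
qed (use assms(2-4,6) in blast)+

lemma polytime_Turing_reducibleI:
  assumes "ptriple Q D (\<lambda>x s. s = init (enc x)) c (\<lambda>x t. ok x (t 0))"
  shows "polytime_Turing_reducible D enc ok Q"
proof -
  have "bounded_state (init v) (vsize v)" for v
    using vsize_ge_1[of v] by (auto simp: bounded_state_def init_def floorlog_def)
  moreover from assms obtain f p where "\<And>k. f k \<le> poly p k" and
    "\<And>x K. x \<in> D \<Longrightarrow> bounded_state (init (enc x)) K \<Longrightarrow>
      \<exists>n t. exec Q c (init (enc x)) n t \<and> n \<le> f K \<and> ok x (t 0)"
    unfolding ptriple_def poly_bounded_def by blast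
  ultimately have "\<exists>n t. exec Q c (init (enc x)) n t \<and> n \<le> poly p (vsize (enc x)) \<and> ok x (t 0)"
    if "x \<in> D" for x using that by (meson le_trans)
  then show ?thesis unfolding polytime_Turing_reducible_def solves_in_polytime_def by blast
qed

section \<open>Separation of energy levels\<close>

lemma sum_le_step:
  fixes e :: "'a \<Rightarrow> real" and f :: "real \<Rightarrow> real"
  assumes "finite W"
    and "\<And>S. S \<in> W \<Longrightarrow> e S \<le> h \<longleftrightarrow> e S \<le> l \<or> e S = h"
    and "\<And>S. S \<in> W \<Longrightarrow> e S = h \<Longrightarrow> \<not> e S \<le> l"
  shows "(\<Sum>S | S \<in> W \<and> e S \<le> h. f (e S)) =
    (\<Sum>S | S \<in> W \<and> e S \<le> l. f (e S)) + real (card {S \<in> W. e S = h}) * f h"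
proof -
  have "{S. S \<in> W \<and> e S \<le> h} = {S. S \<in> W \<and> e S \<le> l} \<union> {S \<in> W. e S = h}"
    using assms(2) by auto
  moreover have "{S. S \<in> W \<and> e S \<le> l} \<inter> {S \<in> W. e S = h} = {}"
    using assms(3) by auto
  ultimately show ?thesis
    using assms(1) by (simp add: sum.union_disjoint)
qed

text \<open>The structures above level \<open>h\<close> together weigh less than a single structure at level \<open>h\<close>,
  because each of them is lighter by a factor of at least \<open>B\<close>, and there are fewer than \<open>B\<close> of them.\<close>

lemma threshold_iff_le_count:
  fixes e :: "'a \<Rightarrow> real" and L B :: real and m :: int
  defines "w \<equiv> \<lambda>x. exp (- x * (L * ln B))"
  assumes W: "finite W" "real (card W) < B" "1 \<le> B"
    and gap: "\<And>S. S \<in> W \<Longrightarrow> h < e S \<Longrightarrow> 1 \<le> L * (e S - h)"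
    and split: "\<And>S. S \<in> W \<Longrightarrow> e S \<le> h \<longleftrightarrow> e S \<le> l \<or> e S = h"
      "\<And>S. S \<in> W \<Longrightarrow> e S = h \<Longrightarrow> \<not> e S \<le> l"
  shows "(\<Sum>S | S \<in> W \<and> e S \<le> l. w (e S)) + of_int m * w h \<le> (\<Sum>S\<in>W. w (e S)) \<longleftrightarrow>
    m \<le> int (card {S \<in> W. e S = h})"
proof -
  define N where "N = card {S \<in> W. e S = h}"
  define R where "R = (\<Sum>S | S \<in> W \<and> h < e S. w (e S))"
  have "(\<Sum>S\<in>W. w (e S)) = (\<Sum>S\<in>{S. S \<in> W \<and> e S \<le> h} \<union> {S. S \<in> W \<and> h < e S}. w (e S))"
    by (intro sum.cong) auto
  also have "\<dots> = (\<Sum>S | S \<in> W \<and> e S \<le> h. w (e S)) + R"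
    unfolding R_def using W(1) by (intro sum.union_disjoint) auto
  finally have total: "(\<Sum>S\<in>W. w (e S)) = (\<Sum>S | S \<in> W \<and> e S \<le> l. w (e S)) + real N * w h + R"
    using sum_le_step[OF W(1) split, where f = w] unfolding N_def by simp
  have wh: "0 < w h" by (simp add: w_def)
  have R0: "0 \<le> R" unfolding R_def by (intro sum_nonneg) (simp add: w_def)
  have le: "w (e S) \<le> w h / B" if "S \<in> W" "h < e S" for S
  proof -
    have "ln B * 1 \<le> ln B * (L * (e S - h))"
      using gap[OF that] W(3) by (intro mult_left_mono) auto
    then have "- e S * (L * ln B) \<le> - h * (L * ln B) - ln B"
      by (simp add: algebra_simps)
    then have "w (e S) \<le> exp (- h * (L * ln B) - ln B)"
      unfolding w_def by simp
    also have "\<dots> = w h / B" using W(3) by (simp add: w_def exp_diff)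
    finally show ?thesis .
  qed
  have "R \<le> real (card {S. S \<in> W \<and> h < e S}) * (w h / B)"
    unfolding R_def using le by (intro sum_bounded_above) auto
  also have "\<dots> \<le> real (card W) * (w h / B)"
    using W wh by (intro mult_right_mono) (auto intro: card_mono)
  also have "\<dots> < B * (w h / B)"
    using W wh by (intro mult_strict_right_mono) auto
  finally have R1: "R < w h" using W(3) by simp
  have "of_int m * w h \<le> real N * w h + R \<longleftrightarrow> m \<le> int N"
  proof
    assume "m \<le> int N"
    then have "of_int m * w h \<le> real N * w h"
      using wh by (intro mult_right_mono) linarith+
    then show "of_int m * w h \<le> real N * w h + R" using R0 by simp
  next
    assume *: "of_int m * w h \<le> real N * w h + R"
    show "m \<le> int N"
    proof (rule ccontr)
      assume "\<not> m \<le> int N"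
      then have "(real N + 1) * w h \<le> of_int m * w h"
        using wh by (intro mult_right_mono) linarith+
      with * R1 show False by (simp add: algebra_simps)
    qed
  qed
  then show ?thesis unfolding total N_def[symmetric] by linarith
qed

lemma card_positions: "finite (positions s)" "card (positions s) = num_bases s"
proof -
  have "positions s = (SIGMA i:{0..<length s}. {..<length (s ! i)})"
    unfolding positions_def by auto
  moreover have "num_bases s = (\<Sum>i = 0..<length s. length (s ! i))"
    unfolding num_bases_def by (simp add: sum_list_sum_nth)
  ultimately show "finite (positions s)" "card (positions s) = num_bases s" by simp_all
qed

lemma card_secondary_structures:
  "finite (secondary_structures s)" "card (secondary_structures s) \<le> 2 ^ (num_bases s)\<^sup>2"
proof -
  let ?f = "\<lambda>(p, q). {p, q}" and ?P = "positions s \<times> positions s"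
  have bp: "base_pairs s \<subseteq> ?f ` ?P" unfolding base_pairs_def by auto
  then have fin: "finite (base_pairs s)" using card_positions by (auto intro: finite_subset)
  have "card (base_pairs s) \<le> card ?P"
    using bp card_positions surj_card_le by (metis finite_cartesian_product)
  then have "card (base_pairs s) \<le> (num_bases s)\<^sup>2"
    by (simp add: card_cartesian_product card_positions power2_eq_square)
  moreover have sub: "secondary_structures s \<subseteq> Pow (base_pairs s)"
    unfolding secondary_structures_def by auto
  then have "card (secondary_structures s) \<le> 2 ^ card (base_pairs s)"
    using card_mono[OF _ sub] fin by (simp add: card_Pow)
  ultimately show "card (secondary_structures s) \<le> 2 ^ (num_bases s)\<^sup>2"
    by (meson le_trans one_le_numeral power_increasing)
  show "finite (secondary_structures s)" using sub fin by (auto intro: finite_subset)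
qed

lemma inj_enc_list: "inj f \<Longrightarrow> inj (enc_list f)"
proof (rule injI)
  fix xs ys assume "inj f" "enc_list f xs = enc_list f ys"
  then show "xs = ys"
  proof (induction xs arbitrary: ys)
    case Nil
    then show ?case by (cases ys) auto
  next
    case (Cons x xs)
    then show ?case by (cases ys) (auto dest: injD)
  qed
qed

lemma inj_enc_base: "inj enc_base"
proof (rule injI)
  fix a b assume "enc_base a = enc_base b"
  then show "a = b" by (cases a; cases b) auto
qed

definition rnum :: "rat \<Rightarrow> int" where "rnum q = fst (quotient_of q)"
definition rden :: "rat \<Rightarrow> int" where "rden q = snd (quotient_of q)"

lemma enc_rat_eq: "enc_rat q = P (I (rnum q)) (I (rden q))"
  by (simp add: enc_rat_def rnum_def rden_def split: prod.split)

lemma rden_pos: "0 < rden q"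
  unfolding rden_def by (rule quotient_of_denom_pos')

lemma rat_eq_rnum_rden: "q = of_int (rnum q) / of_int (rden q)"
  using quotient_of_div[of q] by (simp add: rnum_def rden_def split: prod.splits)

lemma of_rat_eq_rnum_rden: "(of_rat q :: real) = of_int (rnum q) / of_int (rden q)"
  using rat_eq_rnum_rden[of q] by (metis of_rat_divide of_rat_of_int_eq)

lemma rat_less_iff: "rnum p * rden q < rnum q * rden p \<longleftrightarrow> p < q"
proof -
  have "p < q \<longleftrightarrow> (of_int (rnum p) / of_int (rden p) :: rat) < of_int (rnum q) / of_int (rden q)"
    using rat_eq_rnum_rden by metis
  also have "\<dots> \<longleftrightarrow> (of_int (rnum p * rden q) :: rat) < of_int (rnum q * rden p)"
    using rden_pos[of p] rden_pos[of q] by (simp add: divide_simps)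
  finally show ?thesis by (simp only: of_int_less_iff)
qed

lemma rnum_of_int [simp]: "rnum (of_int a) = a" and rden_of_int [simp]: "rden (of_int a) = 1"
  by (simp_all add: rnum_def rden_def)

lemma inj_enc_rat: "inj enc_rat"
  by (rule injI) (metis enc_rat_eq rat_eq_rnum_rden val.inject)

lemma inj_enc_rexp: "inj enc_rexp"
proof (rule injI)
  fix a b assume "enc_rexp a = enc_rexp b"
  then show "a = b"
  proof (induction a arbitrary: b)
  qed (case_tac b; force)+
qed

lemma inj_on_enc_input:
  assumes "inj_on enc_model {M. \<exists>s T. (s, T, M) \<in> inputs}"
  shows "inj_on (enc_input enc_model) inputs"
proof (rule inj_onI)
  fix x y assume *: "x \<in> inputs" "y \<in> inputs" "enc_input enc_model x = enc_input enc_model y"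
  obtain s T M s' T' M' where xy: "x = (s, T, M)" "y = (s', T', M')" by (metis prod_cases3)
  with * assms show "x = y"
    by (auto dest: inj_onD injD[OF inj_enc_rat] injD[OF inj_enc_list[OF inj_enc_list[OF inj_enc_base]]])
qed

lemma mem_dPF_magnified_iff:
  assumes "inj_on enc_model {M. \<exists>s T. (s, T, M) \<in> inputs}" and "(s, T, M) \<in> inputs"
    and "well_defined kB a" "well_defined kB k" "0 < reval kB a"
  shows "P (enc_input enc_model (s, T, M)) (P (enc_rexp a) (enc_rexp k)) \<in>
      dPF_magnified kB \<Omega> inputs enc_model \<longleftrightarrow>
    dPF kB \<Omega> s (of_rat T) (magnify (reval kB a) M) (reval kB k)"
proof
  assume "P (enc_input enc_model (s, T, M)) (P (enc_rexp a) (enc_rexp k)) \<in>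
    dPF_magnified kB \<Omega> inputs enc_model"
  then obtain s' T' M' a' k' where
    eq: "enc_input enc_model (s, T, M) = enc_input enc_model (s', T', M')"
      "enc_rexp a = enc_rexp a'" "enc_rexp k = enc_rexp k'" and
    *: "(s', T', M') \<in> inputs" "dPF kB \<Omega> s' (of_rat T') (magnify (reval kB a') M') (reval kB k')"
    unfolding dPF_magnified_def by blast
  have "(s, T, M) = (s', T', M')"
    using inj_onD[OF inj_on_enc_input[OF assms(1)] eq(1) assms(2) *(1)] .
  moreover have "a = a'" "k = k'" using eq(2,3) injD[OF inj_enc_rexp] by blast+
  ultimately show "dPF kB \<Omega> s (of_rat T) (magnify (reval kB a) M) (reval kB k)" using * by simp
next
  assume "dPF kB \<Omega> s (of_rat T) (magnify (reval kB a) M) (reval kB k)"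
  with assms show "P (enc_input enc_model (s, T, M)) (P (enc_rexp a) (enc_rexp k)) \<in>
    dPF_magnified kB \<Omega> inputs enc_model"
    unfolding dPF_magnified_def by blast
qed

section \<open>The program\<close>

abbreviation (input) "v_input \<equiv> 1 :: nat"
abbreviation (input) "v_levels \<equiv> 2 :: nat"
abbreviation (input) "v_bound \<equiv> 3 :: nat"
abbreviation (input) "v_denom \<equiv> 4 :: nat"
abbreviation (input) "v_top \<equiv> 5 :: nat"
abbreviation (input) "v_alpha \<equiv> 6 :: nat"
abbreviation (input) "v_thr \<equiv> 7 :: nat"
abbreviation (input) "v_out \<equiv> 8 :: nat"
abbreviation (input) "v_last \<equiv> 9 :: nat"
abbreviation (input) "v_next \<equiv> 10 :: nat"
abbreviation (input) "v_rounds \<equiv> 11 :: nat"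
abbreviation (input) "v_list \<equiv> 12 :: nat"
abbreviation (input) "v_strand \<equiv> 13 :: nat"
abbreviation (input) "v_count \<equiv> 14 :: nat"
abbreviation (input) "v_step \<equiv> 15 :: nat"
abbreviation (input) "v_answer \<equiv> 16 :: nat"
abbreviation (input) "v_weight \<equiv> 17 :: nat"

abbreviation (input) "p_num a \<equiv> MkPair (Const 0) a"
abbreviation (input) "p_boltz \<equiv> MkPair (Const 1) (Const 0)"
abbreviation (input) "p_add a b \<equiv> MkPair (Const 2) (MkPair a b)"
abbreviation (input) "p_mul a b \<equiv> MkPair (Const 4) (MkPair a b)"
abbreviation (input) "p_div a b \<equiv> MkPair (Const 5) (MkPair a b)"
abbreviation (input) "p_exp a \<equiv> MkPair (Const 6) a"
abbreviation (input) "p_ln a \<equiv> MkPair (Const 7) a"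

lemma truth_eq_0 [simp]: "truth b = I 0 \<longleftrightarrow> \<not> b"
  by (simp add: truth_def)

lemma vsize_small [simp]:
  "vsize (I 0) = 1" "vsize (I 1) = 2" "vsize (I 2) = 3" "vsize (I 3) = 3"
  "vsize (I 4) = 4" "vsize (I 5) = 4" "vsize (I 6) = 4" "vsize (I 7) = 4"
  by (simp_all add: compute_floorlog)

lemma vsize_power2: "vsize (I (2 ^ k)) = k + 2"
  using floorlog_power[of 1 2 k] by (simp add: nat_power_eq floorlog_def[of 2 "Suc 0"])

declare vsize.simps(1) [simp del]

lemma vsize_mono: "0 \<le> a \<Longrightarrow> a \<le> b \<Longrightarrow> vsize (I a) \<le> vsize (I b)"
  by (auto simp: vsize.simps intro!: floorlog_mono)

definition count_strand :: com where
  "count_strand = While (IsPair (Var v_strand))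
    (Seq (Assign v_bound (Mul (Mul (Var v_bound) (Var v_count)) (Const 2)))
    (Seq (Assign v_count (Mul (Var v_count) (Const 4)))
         (Assign v_strand (Right (Var v_strand)))))"

text \<open>\<open>v_bound\<close> and \<open>v_count\<close> hold \<open>2 ^ c\<^sup>2\<close> and \<open>4 ^ c\<close> once \<open>c\<close> bases have been read.\<close>

definition count_bases :: com where
  "count_bases =
    Seq (Assign v_list (Left (Var v_input)))
    (Seq (Assign v_count (Const 1))
    (Seq (Assign v_bound (Const 1))
         (While (IsPair (Var v_list))
           (Seq (Assign v_strand (Left (Var v_list)))
           (Seq count_strand (Assign v_list (Right (Var v_list))))))))"

lemma length_le_vsize: "length w \<le> vsize (enc_list f w)"
  by (induction w) auto

lemma vsize_enc_bases: "vsize (enc_list enc_base w) \<le> 1 + 4 * length w"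
proof (induction w)
  case (Cons b w)
  have "vsize (enc_base b) \<le> 3" by (cases b) auto
  with Cons show ?case by simp
qed simp

lemma count_strand_correct:
  "ptriple Q UNIV
    (\<lambda>(c, w) s. s v_strand = enc_list enc_base w \<and> s v_bound = I (2 ^ c\<^sup>2) \<and> s v_count = I (4 ^ c))
    count_strand
    (\<lambda>(c, w) t. t v_strand = I 0 \<and> t v_bound = I (2 ^ (c + length w)\<^sup>2) \<and>
      t v_count = I (4 ^ (c + length w)))"
proof -
  define Inv where "Inv = (\<lambda>(c, w :: base list) K s. c \<le> K \<and> length w \<le> K \<and>
    (\<exists>c' w'. c' + length w' = c + length w \<and> s v_strand = enc_list enc_base w' \<and>
      s v_bound = I (2 ^ c'\<^sup>2) \<and> s v_count = I (4 ^ c')))"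
  have p4: "(4::int) ^ c = 2 ^ (2 * c)" for c by (simp add: power_mult)
  show ?thesis
    unfolding count_strand_def
  proof (rule ptriple_while_straight[where v = v_strand and Inv = Inv and
          g = "\<lambda>K. 4 * K * K + 8 * K + 3"], goal_cases)
    case 1
    show ?case by simp
  next
    case 2
    show ?case by (intro poly_bounded_intros)
  next
    case (3 i s K)
    obtain c w where i: "i = (c, w)" by fastforce
    have "vsize (s v_strand) \<le> K" "vsize (s v_count) \<le> K" using 3 by (auto simp: bounded_state_def)
    with 3 length_le_vsize[of w enc_base] show ?case
      by (auto simp: i Inv_def p4 vsize_power2)
  next
    case (4 i s K y)
    obtain c w where i: "i = (c, w)" by fastforce
    from 4 obtain c' w' where *: "c' + length w' = c + length w" "c \<le> K" "length w \<le> K"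
      "s v_strand = enc_list enc_base w'" "s v_bound = I (2 ^ c'\<^sup>2)" "s v_count = I (4 ^ c')"
      by (auto simp: i Inv_def)
    then have "c' \<le> 2 * K" "length w' \<le> 2 * K" by auto
    moreover from this have "c'\<^sup>2 \<le> 4 * K * K"
      using mult_le_mono[of c' "2 * K" c' "2 * K"] by (simp add: power2_eq_square)
    moreover have "vsize (s v_bound) = c'\<^sup>2 + 2" "vsize (s v_count) = 2 * c' + 2"
      "vsize (s v_strand) \<le> 1 + 4 * length w'"
      using * vsize_enc_bases[of w'] by (simp_all only: p4 vsize_power2)
    ultimately show ?case using 4(4) by auto
  next
    case (5 i s K)
    obtain c w where i: "i = (c, w)" by fastforce
    from 5 obtain c' w' where *: "c' + length w' = c + length w" "c \<le> K" "length w \<le> K"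
      "s v_strand = enc_list enc_base w'" "s v_bound = I (2 ^ c'\<^sup>2)" "s v_count = I (4 ^ c')"
      "is_pair (s v_strand)"
      by (auto simp: i Inv_def)
    then obtain b w'' where w': "w' = b # w''" by (cases w') auto
    have "(Suc c')\<^sup>2 = c'\<^sup>2 + 2 * c' + 1" by (simp add: power2_eq_square)
    then have "(2::int) ^ (Suc c')\<^sup>2 = 2 ^ c'\<^sup>2 * 4 ^ c' * 2"
      by (simp only: p4 power_add power_one_right)
    with * w' show ?case
      unfolding Inv_def i by (auto intro!: exI[of _ "Suc c'"] exI[of _ w''])
  next
    case (6 i K t)
    obtain c w where i: "i = (c, w)" by fastforce
    from 6 obtain c' w' where *: "c' + length w' = c + length w"
      "t v_strand = enc_list enc_base w'" "t v_bound = I (2 ^ c'\<^sup>2)" "t v_count = I (4 ^ c')"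
      "\<not> is_pair (t v_strand)"
      by (auto simp: i Inv_def)
    then have "w' = []" by (cases w') auto
    with * show ?case by (simp add: i)
  qed
qed

lemma num_bases_simps [simp]: "num_bases [] = 0" "num_bases (w # ws) = length w + num_bases ws"
  by (simp_all add: num_bases_def)

lemma num_bases_le_vsize: "num_bases ws \<le> vsize (enc_list (enc_list enc_base) ws)"
proof (induction ws)
  case (Cons w ws)
  then show ?case using length_le_vsize[of w enc_base] by simp
qed simp

lemma count_bases_correct:
  "ptriple Q UNIV (\<lambda>ws s. left (s v_input) = enc_list (enc_list enc_base) ws) count_bases
    (\<lambda>ws t. t v_bound = I (2 ^ (num_bases ws)\<^sup>2))"
proof -
  define A where "A = (\<lambda>n c ws s. c + num_bases ws = n \<and> s v_list = enc_list (enc_list enc_base) ws \<and>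
      s v_bound = I (2 ^ c\<^sup>2) \<and> s v_count = I (4 ^ c))"
  define Inv where "Inv = (\<lambda>ws0 K s. num_bases ws0 \<le> K \<and> vsize (s v_list) \<le> K \<and>
    vsize (s v_strand) \<le> K \<and> (\<exists>c ws. A (num_bases ws0) c ws s))"
  define J where "J = (\<lambda>(ws0, K :: nat, m) s. num_bases ws0 \<le> K \<and> vsize (s v_list) \<le> K \<and> vsize (s v_list) = m)"
  have p4: "(4::int) ^ c = 2 ^ (2 * c)" for c by (simp add: power_mult)
  have body: "ptriple Q (UNIV \<times> UNIV)
     (\<lambda>(i, K, m) s. Inv i K s \<and> peval (IsPair (Var v_list)) s \<noteq> I 0 \<and> vsize (s v_list) = m)
     (Seq (Assign v_strand (Left (Var v_list))) (Seq count_strand (Assign v_list (Right (Var v_list)))))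
     (\<lambda>(i, K, m) t. Inv i K t \<and> vsize (t v_list) < m)"
  proof (rule ptriple_seq[where B = "\<lambda>j s. J j s \<and>
      (\<exists>c w ws. A (num_bases (fst j)) c (w # ws) s \<and> s v_strand = enc_list enc_base w)"],
      goal_cases)
    case 1
    show ?case
    proof (rule ptriple_straight, goal_cases)
      case (2 j s)
      obtain ws0 K m where j: "j = (ws0, K, m)" by (metis prod.exhaust)
      from 2 obtain c ws where *: "A (num_bases ws0) c ws s" "is_pair (s v_list)"
        by (auto simp: j Inv_def)
      then obtain w ws' where "ws = w # ws'" by (cases ws) (auto simp: A_def)
      with * 2 show ?case by (auto simp: j J_def Inv_def A_def)
    qed simp
  next
    case 2
    show ?case
    proof (rule ptriple_seq[where B = "\<lambda>j s. J j s \<and> s v_strand = I 0 \<and>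
      (\<exists>c ws. A (num_bases (fst j)) c ws (s(v_list := right (s v_list))) \<and> is_pair (s v_list))"],
        goal_cases)
      case 1
      show ?case
      proof (rule ptriple_apply[OF count_strand_correct], goal_cases)
        case (1 j s)
        then obtain c w ws where *: "J j s" "A (num_bases (fst j)) c (w # ws) s"
          "s v_strand = enc_list enc_base w" by blast
        show ?case
        proof (rule bexI[of _ "(c, w)"], rule conjI, goal_cases)
          case 2
          show ?case
          proof (intro allI impI, goal_cases)
            case (1 t)
            have "t v_list = s v_list" using 1(2) by (simp add: count_strand_def)
            with 1(1) * show ?case by (auto simp: J_def A_def intro!: exI[of _ "c + length w"] exI[of _ ws])
          qed
        qed (use * in \<open>auto simp: A_def\<close>)
      qed
    next
      case 2
      show ?case
      proof (rule ptriple_straight, goal_cases)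
        case (2 j s)
        obtain ws0 K m where j: "j = (ws0, K, m)" by (metis prod.exhaust)
        from 2 obtain a b where ab: "s v_list = P a b" by (cases "s v_list") auto
        with 2 have "m = 1 + vsize a + vsize b" "m \<le> K" by (auto simp: j J_def)
        with 2 ab show ?case by (auto simp: j J_def Inv_def)
      qed simp
    qed
  qed
  have loop: "ptriple Q UNIV (\<lambda>ws s. A (num_bases ws) 0 ws s)
    (While (IsPair (Var v_list))
      (Seq (Assign v_strand (Left (Var v_list))) (Seq count_strand (Assign v_list (Right (Var v_list))))))
    (\<lambda>ws t. t v_bound = I (2 ^ (num_bases ws)\<^sup>2))"
  proof (rule ptriple_while[where v = v_list and Inv = Inv and g = "\<lambda>K. K * K + 2 * K + 2",
        OF _ _ _ body], goal_cases)
    case 1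
    show ?case by (intro poly_bounded_intros)
  next
    case (2 ws s K)
    have "vsize (s v_list) \<le> K" "vsize (s v_strand) \<le> K" using 2 by (auto simp: bounded_state_def)
    with 2 num_bases_le_vsize[of ws] show ?case by (auto simp: Inv_def A_def)
  next
    case (3 ws0 s K y)
    then obtain c ws where *: "c + num_bases ws = num_bases ws0" "num_bases ws0 \<le> K"
      "s v_bound = I (2 ^ c\<^sup>2)" "s v_count = I (4 ^ c)" "vsize (s v_list) \<le> K" "vsize (s v_strand) \<le> K"
      by (auto simp: Inv_def A_def)
    then have "c \<le> K" by simp
    moreover from this have "c\<^sup>2 \<le> K * K"
      using mult_le_mono[of c K c K] by (simp add: power2_eq_square)
    moreover have "vsize (s v_bound) = c\<^sup>2 + 2" "vsize (s v_count) = 2 * c + 2"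
      using * by (simp_all only: p4 vsize_power2)
    ultimately show ?case using 3(4) * by (auto simp: count_strand_def)
  next
    case (4 ws0 K t)
    then obtain c ws where *: "c + num_bases ws = num_bases ws0" "t v_list = enc_list (enc_list enc_base) ws"
      "t v_bound = I (2 ^ c\<^sup>2)" "\<not> is_pair (t v_list)"
      by (auto simp: Inv_def A_def)
    then have "ws = []" by (cases ws) auto
    with * show ?case by simp
  qed
  show ?thesis
    unfolding count_bases_def
    by (rule ptriple_pre[OF ptriple_straight_seq[OF ptriple_straight_seq[OF ptriple_straight_seq[OF loop]]]])
      (auto simp: A_def)
qed

definition common_denominator :: "rat list \<Rightarrow> int" where
  "common_denominator gs = prod_list (map rden gs)"

definition strict_upper_bound :: "rat list \<Rightarrow> int" where
  "strict_upper_bound gs = 1 + sum_list (map (\<lambda>g. rnum g * rnum g) gs)"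

abbreviation "enc_levels \<equiv> enc_list enc_rat"

definition scan_levels :: com where
  "scan_levels =
    Seq (Assign v_list (Var v_levels))
    (Seq (Assign v_denom (Const 1))
    (Seq (Assign v_top (Const 1))
         (While (IsPair (Var v_list))
           (Seq (Assign v_denom (Mul (Var v_denom) (Right (Left (Var v_list)))))
           (Seq (Assign v_top (Add (Var v_top) (Mul (Left (Left (Var v_list))) (Left (Left (Var v_list))))))
                (Assign v_list (Right (Var v_list))))))))"

lemma vsize_common_denominator: "vsize (I (common_denominator gs)) \<le> 2 + vsize (enc_levels gs)"
proof (induction gs)
  case (Cons g gs)
  then show ?case using vsize_mult[of "rden g" "common_denominator gs"]
    by (simp add: common_denominator_def enc_rat_eq)
qed (simp add: common_denominator_def)

lemma vsize_strict_upper_bound: "vsize (I (strict_upper_bound gs)) \<le> 2 + 2 * vsize (enc_levels gs)"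
proof (induction gs)
  case (Cons g gs)
  have "strict_upper_bound (g # gs) = rnum g * rnum g + strict_upper_bound gs"
    by (simp add: strict_upper_bound_def)
  with Cons show ?case
    using vsize_add[of "rnum g * rnum g" "strict_upper_bound gs"] vsize_mult[of "rnum g" "rnum g"]
    by (simp add: enc_rat_eq)
qed (simp add: strict_upper_bound_def)

lemma vsize_enc_list_append:
  "vsize (enc_list f xs) \<le> vsize (enc_list f (xs @ ys))"
  "vsize (enc_list f ys) \<le> vsize (enc_list f (xs @ ys))"
proof -
  show "vsize (enc_list f xs) \<le> vsize (enc_list f (xs @ ys))"
    by (induction xs) (auto simp: vsize_ge_1[unfolded One_nat_def])
  show "vsize (enc_list f ys) \<le> vsize (enc_list f (xs @ ys))"
    by (induction xs) auto
qed

lemma vsize_le_enc_list: "x \<in> set xs \<Longrightarrow> vsize (f x) \<le> vsize (enc_list f xs)"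
  by (induction xs) auto

lemma enc_list_is_pair: "is_pair (enc_list f xs) \<longleftrightarrow> xs \<noteq> []"
  by (cases xs) auto

lemma scan_levels_correct:
  "ptriple Q UNIV (\<lambda>gs s. s v_levels = enc_levels gs) scan_levels
    (\<lambda>gs t. t v_denom = I (common_denominator gs) \<and> t v_top = I (strict_upper_bound gs))"
proof -
  define Inv where "Inv = (\<lambda>gs K s. vsize (enc_levels gs) \<le> K \<and> (\<exists>ps qs. gs = ps @ qs \<and>
    s v_list = enc_levels qs \<and> s v_denom = I (common_denominator ps) \<and>
    s v_top = I (strict_upper_bound ps)))"
  have loop: "ptriple Q UNIV (\<lambda>gs s. s v_list = enc_levels gs \<and> s v_denom = I 1 \<and> s v_top = I 1)
    (While (IsPair (Var v_list))
           (Seq (Assign v_denom (Mul (Var v_denom) (Right (Left (Var v_list)))))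
           (Seq (Assign v_top (Add (Var v_top) (Mul (Left (Left (Var v_list))) (Left (Left (Var v_list))))))
                (Assign v_list (Right (Var v_list))))))
    (\<lambda>gs t. t v_denom = I (common_denominator gs) \<and> t v_top = I (strict_upper_bound gs))"
  proof (rule ptriple_while_straight[where v = v_list and Inv = Inv and g = "\<lambda>K. 2 * K + 2"], goal_cases)
    case 1
    show ?case by simp
  next
    case 2
    show ?case by (intro poly_bounded_intros)
  next
    case (3 gs s K)
    have "vsize (s v_list) \<le> K" using 3(2) by (auto simp: bounded_state_def)
    with 3(3) show ?case
      by (auto simp: Inv_def)
        (rule exI[of _ "[]"], simp add: common_denominator_def strict_upper_bound_def)
  next
    case (4 gs s K y)
    then obtain ps qs where *: "gs = ps @ qs" "vsize (enc_levels gs) \<le> K"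
      "s v_list = enc_levels qs" "s v_denom = I (common_denominator ps)"
      "s v_top = I (strict_upper_bound ps)"
      by (auto simp: Inv_def)
    with 4(4) vsize_common_denominator[of ps] vsize_strict_upper_bound[of ps]
      vsize_enc_list_append[of enc_rat ps qs] vsize_enc_list_append[of enc_rat qs ps]
    show ?case by auto
  next
    case (5 gs s K)
    then obtain ps qs where *: "gs = ps @ qs" "vsize (enc_levels gs) \<le> K"
      "s v_list = enc_levels qs" "s v_denom = I (common_denominator ps)"
      "s v_top = I (strict_upper_bound ps)" "qs \<noteq> []"
      by (auto simp: Inv_def enc_list_is_pair)
    then obtain q qs' where q: "qs = q # qs'" by (cases qs) auto
    show ?case
      unfolding Inv_def
      by (rule conjI, rule conjI, rule *(2), rule exI[of _ "ps @ [q]"], rule exI[of _ qs'])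
        (use * q in \<open>auto simp: common_denominator_def strict_upper_bound_def enc_rat_eq\<close>)
  next
    case (6 gs K t)
    then show ?case by (auto simp: Inv_def enc_list_is_pair)
  qed
  show ?thesis
    unfolding scan_levels_def
    by (rule ptriple_pre[OF ptriple_straight_seq[OF ptriple_straight_seq[OF ptriple_straight_seq[OF loop]]]])
      auto
qed

definition next_level :: "rat list \<Rightarrow> int \<Rightarrow> rat \<Rightarrow> rat" where
  "next_level gs a l = Min (insert (of_int a) {g \<in> set gs. l < g})"

definition find_next :: com where
  "find_next =
    Seq (Assign v_list (Var v_levels))
    (Seq (Assign v_next (MkPair (Var v_top) (Const 1)))
         (While (IsPair (Var v_list))
           (Seq (Cond (Mul
                  (Less (Mul (Left (Var v_last)) (Right (Left (Var v_list))))
                        (Mul (Left (Left (Var v_list))) (Right (Var v_last))))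
                  (Less (Mul (Left (Left (Var v_list))) (Right (Var v_next)))
                        (Mul (Left (Var v_next)) (Right (Left (Var v_list))))))
                  (Assign v_next (Left (Var v_list))) Skip)
                (Assign v_list (Right (Var v_list))))))"

lemma next_level_mem: "next_level gs a l \<in> insert (of_int a) {g \<in> set gs. l < g}"
  unfolding next_level_def by (rule Min_in) auto

lemma vsize_next_level:
  "vsize (enc_rat (next_level gs a l)) \<le> vsize (enc_levels gs) + vsize (I a) + 3"
  using next_level_mem[of gs a l] vsize_le_enc_list[of "next_level gs a l" gs enc_rat]
  by (auto simp: enc_rat_eq)

lemma next_level_snoc:
  "next_level (gs @ [q]) a l = (if l < q \<and> q < next_level gs a l then q else next_level gs a l)"
proof (cases "l < q")
  case True
  then have "insert (of_int a) {g \<in> set (gs @ [q]). l < g} = insert q (insert (of_int a) {g \<in> set gs. l < g})"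
    by auto
  then have "next_level (gs @ [q]) a l = min q (next_level gs a l)"
    unfolding next_level_def by (simp only:) (subst Min_insert, auto)
  with True show ?thesis by auto
next
  case False
  then have "{g \<in> set (gs @ [q]). l < g} = {g \<in> set gs. l < g}" by auto
  with False show ?thesis unfolding next_level_def by simp
qed

lemma find_next_correct:
  "ptriple Q UNIV
    (\<lambda>(gs, a, l) s. s v_levels = enc_levels gs \<and> s v_top = I a \<and> s v_last = enc_rat l)
    find_next
    (\<lambda>(gs, a, l) t. t v_next = enc_rat (next_level gs a l) \<and> t v_list = I 0)"
proof -
  define Inv where "Inv = (\<lambda>(gs, a, l) K s. vsize (enc_levels gs) \<le> K \<and> vsize (I a) \<le> K \<and>
    s v_last = enc_rat l \<and> (\<exists>ps qs. gs = ps @ qs \<and>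
    s v_list = enc_levels qs \<and> s v_next = enc_rat (next_level ps a l)))"
  have loop: "ptriple Q UNIV
    (\<lambda>(gs, a, l) s. s v_list = enc_levels gs \<and> s v_top = I a \<and> s v_last = enc_rat l \<and>
      s v_next = enc_rat (next_level [] a l))
    (While (IsPair (Var v_list))
           (Seq (Cond (Mul
                  (Less (Mul (Left (Var v_last)) (Right (Left (Var v_list))))
                        (Mul (Left (Left (Var v_list))) (Right (Var v_last))))
                  (Less (Mul (Left (Left (Var v_list))) (Right (Var v_next)))
                        (Mul (Left (Var v_next)) (Right (Left (Var v_list))))))
                  (Assign v_next (Left (Var v_list))) Skip)
                (Assign v_list (Right (Var v_list)))))
    (\<lambda>(gs, a, l) t. t v_next = enc_rat (next_level gs a l) \<and> t v_list = I 0)"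
  proof (rule ptriple_while_straight[where v = v_list and Inv = Inv and g = "\<lambda>K. 2 * K + 3"], goal_cases)
    case 1
    show ?case by simp
  next
    case 2
    show ?case by (intro poly_bounded_intros)
  next
    case (3 i s K)
    have "vsize (s v_list) \<le> K" "vsize (s v_top) \<le> K" using 3(2) by (auto simp: bounded_state_def)
    with 3(3) show ?case
      by (auto simp: Inv_def)
  next
    case (4 i s K y)
    obtain gs a l where i: "i = (gs, a, l)" by (metis prod.exhaust)
    from 4 obtain ps qs where *: "gs = ps @ qs" "vsize (enc_levels gs) \<le> K" "vsize (I a) \<le> K"
      "s v_list = enc_levels qs" "s v_next = enc_rat (next_level ps a l)"
      by (auto simp: Inv_def i)
    with 4(4) vsize_next_level[of ps a l]
      vsize_enc_list_append[of enc_rat ps qs] vsize_enc_list_append[of enc_rat qs ps]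
    show ?case by auto
  next
    case (5 i s K)
    obtain gs a l where i: "i = (gs, a, l)" by (metis prod.exhaust)
    from 5 obtain ps qs where *: "gs = ps @ qs" "vsize (enc_levels gs) \<le> K" "vsize (I a) \<le> K"
      "s v_list = enc_levels qs" "s v_next = enc_rat (next_level ps a l)" "s v_last = enc_rat l" "qs \<noteq> []"
      by (auto simp: Inv_def i enc_list_is_pair)
    then obtain q qs' where q: "qs = q # qs'" by (cases qs) auto
    let ?h = "next_level ps a l"
    let ?t = "run Q (Seq (Cond (Mul
                  (Less (Mul (Left (Var v_last)) (Right (Left (Var v_list))))
                        (Mul (Left (Left (Var v_list))) (Right (Var v_last))))
                  (Less (Mul (Left (Left (Var v_list))) (Right (Var v_next)))
                        (Mul (Left (Var v_next)) (Right (Left (Var v_list))))))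
                  (Assign v_next (Left (Var v_list))) Skip)
                (Assign v_list (Right (Var v_list)))) s"
    have t: "?t = (if l < q \<and> q < ?h then s(v_next := enc_rat q) else s)(v_list := enc_levels qs')"
      using * rat_less_iff[of l q] rat_less_iff[of q ?h]
      by (simp add: q enc_rat_eq truth_def)
    have "\<exists>ps' qs''. gs = ps' @ qs'' \<and> ?t v_list = enc_levels qs'' \<and> ?t v_next = enc_rat (next_level ps' a l)"
      unfolding t by (rule exI[of _ "ps @ [q]"], rule exI[of _ qs']) (use * q in \<open>auto simp: next_level_snoc\<close>)
    then show ?case
      using * unfolding t by (auto simp: Inv_def i q)
  next
    case (6 i K t)
    then show ?case by (auto simp: Inv_def enc_list_is_pair)
  qed
  show ?thesis
    unfolding find_next_def
    by (rule ptriple_pre[OF ptriple_straight_seq[OF ptriple_straight_seq[OF loop]]])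
      (auto simp: enc_rat_eq next_level_def)
qed

definition binary_search :: com where
  "binary_search =
    Seq (Assign v_answer (Const 0))
    (Seq (Assign v_count (Const 0))
    (Seq (Assign v_step (Var v_bound))
         (While (Var v_step)
           (Seq (Ask v_answer (MkPair (Var v_input) (MkPair (Var v_alpha)
                  (p_add (Var v_thr) (p_mul (p_num (Add (Var v_count) (Var v_step))) (Var v_weight))))))
           (Seq (Cond (Var v_answer) (Assign v_count (Add (Var v_count) (Var v_step))) Skip)
                (Assign v_step (Div (Var v_step) (Const 2))))))))"

text \<open>An index \<open>(x, \<alpha>, \<theta>, w, b, N)\<close> of the specification of the search: the values of the query
  parameters, the exponent of the initial bound, and the largest \<open>m\<close> for which the query succeeds.\<close>

definition searchable :: "val set \<Rightarrow> (val \<times> val \<times> val \<times> val \<times> nat \<times> int) set" where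
  "searchable Q = {(x, \<alpha>, \<theta>, w, b, N). 0 \<le> N \<and> N \<le> 2 ^ b \<and>
    (\<forall>m. P x (P \<alpha> (P (I 2) (P \<theta> (P (I 4) (P (P (I 0) (I m)) w))))) \<in> Q \<longleftrightarrow> m \<le> N)}"

lemma binary_search_correct:
  "ptriple Q (searchable Q)
    (\<lambda>(x, \<alpha>, \<theta>, w, b, N) s. s v_input = x \<and> s v_alpha = \<alpha> \<and> s v_thr = \<theta> \<and> s v_weight = w \<and> s v_bound = I (2 ^ b))
    binary_search
    (\<lambda>(x, \<alpha>, \<theta>, w, b, N) t. t v_count = I N \<and> t v_step = I 0 \<and> vsize (t v_answer) \<le> 2)"
proof -
  define Inv where "Inv = (\<lambda>(x, \<alpha>, \<theta>, w, b, N :: int) K s.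
    s v_input = x \<and> s v_alpha = \<alpha> \<and> s v_thr = \<theta> \<and> s v_weight = w \<and> b \<le> K \<and> vsize (s v_answer) \<le> 2 \<and>
    (\<exists>c. s v_count = I c \<and> 0 \<le> c \<and> c \<le> N \<and>
      (s v_step = I 0 \<and> c = N \<or> (\<exists>k\<le>b. s v_step = I (2 ^ k) \<and> N < c + 2 ^ Suc k))))"
  have loop: "ptriple Q (searchable Q)
    (\<lambda>(x, \<alpha>, \<theta>, w, b, N) s. s v_input = x \<and> s v_alpha = \<alpha> \<and> s v_thr = \<theta> \<and> s v_weight = w \<and>
      s v_answer = I 0 \<and> s v_count = I 0 \<and> s v_step = I (2 ^ b))
    (While (Var v_step)
           (Seq (Ask v_answer (MkPair (Var v_input) (MkPair (Var v_alpha)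
                  (p_add (Var v_thr) (p_mul (p_num (Add (Var v_count) (Var v_step))) (Var v_weight))))))
           (Seq (Cond (Var v_answer) (Assign v_count (Add (Var v_count) (Var v_step))) Skip)
                (Assign v_step (Div (Var v_step) (Const 2))))))
    (\<lambda>(x, \<alpha>, \<theta>, w, b, N) t. t v_count = I N \<and> t v_step = I 0 \<and> vsize (t v_answer) \<le> 2)"
  proof (rule ptriple_while_straight[where v = v_step and Inv = Inv and g = "\<lambda>K. K + 3"], goal_cases)
    case 1
    show ?case by simp
  next
    case 2
    show ?case by (intro poly_bounded_intros)
  next
    case (3 i s K)
    obtain x \<alpha> \<theta> w b N where i: "i = (x, \<alpha>, \<theta>, w, b, N)" by (metis prod.exhaust)
    have "vsize (s v_step) \<le> K" using 3 by (auto simp: bounded_state_def)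
    moreover have "N < 2 ^ Suc b" using 3(1) by (auto simp: i searchable_def intro: le_less_trans)
    ultimately show ?case using 3
      by (auto simp: Inv_def i vsize_power2 searchable_def)
  next
    case (4 i s K y)
    obtain x \<alpha> \<theta> w b N where i: "i = (x, \<alpha>, \<theta>, w, b, N)" by (metis prod.exhaust)
    from 4(2) obtain c where c: "s v_count = I c" "0 \<le> c" "c \<le> N" "b \<le> K" "vsize (s v_answer) \<le> 2"
      "s v_step = I 0 \<or> (\<exists>k\<le>b. s v_step = I (2 ^ k))"
      by (auto simp: Inv_def i)
    have "c \<le> 2 ^ b" using c 4(1) by (auto simp: i searchable_def)
    then have "vsize (s v_count) \<le> b + 2" using vsize_mono[OF c(2)] c(1) vsize_power2[of b] by metis
    moreover have "vsize (s v_step) \<le> b + 2" using c(6) by (auto simp: vsize_power2)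
    ultimately show ?case using 4(4) c by auto
  next
    case (5 i s K)
    obtain x \<alpha> \<theta> w b N where i: "i = (x, \<alpha>, \<theta>, w, b, N)" by (metis prod.exhaust)
    from 5(2,3) obtain c k where c: "s v_input = x" "s v_alpha = \<alpha>" "s v_thr = \<theta>" "s v_weight = w"
      "s v_count = I c" "0 \<le> c" "c \<le> N" "b \<le> K"
      "s v_step = I (2 ^ k)" "k \<le> b" "N < c + 2 ^ Suc k"
      by (auto simp: Inv_def i)
    let ?body = "Seq (Ask v_answer (MkPair (Var v_input) (MkPair (Var v_alpha)
                  (p_add (Var v_thr) (p_mul (p_num (Add (Var v_count) (Var v_step))) (Var v_weight))))))
           (Seq (Cond (Var v_answer) (Assign v_count (Add (Var v_count) (Var v_step))) Skip)
                (Assign v_step (Div (Var v_step) (Const 2))))"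
    define c' where "c' = (if c + 2 ^ k \<le> N then c + 2 ^ k else c)"
    have run: "run Q ?body s = s(v_answer := truth (c + 2 ^ k \<le> N), v_count := I c', v_step := I (2 ^ k div 2))"
      using 5(1) c by (auto simp: i searchable_def truth_def c'_def fun_eq_iff)
    have c': "0 \<le> c'" "c' \<le> N" "N < c' + 2 ^ k" using c by (auto simp: c'_def)
    show ?case
    proof (cases k)
      case 0
      with c c' show ?thesis unfolding run
        by (auto simp: Inv_def i vsize_truth)
    next
      case (Suc k')
      then have "(2::int) ^ k div 2 = 2 ^ k'" "vsize (I (2 ^ k')) < vsize (I (2 ^ k))"
        by (simp, simp only: vsize_power2)
      with Suc c c' show ?thesis unfolding run
        by (auto simp: Inv_def i vsize_truth intro!: exI[of _ k'])
    qed
  next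
    case (6 i K t)
    then show ?case by (auto simp: Inv_def)
  qed
  show ?thesis
    unfolding binary_search_def
    by (rule ptriple_pre[OF ptriple_straight_seq[OF ptriple_straight_seq[OF ptriple_straight_seq[OF loop]]]])
      auto
qed

section \<open>Correctness of the reduction\<close>

lemma common_denominator_pos: "0 < common_denominator gs"
  unfolding common_denominator_def by (induction gs) (auto simp: rden_pos)

lemma rden_dvd_common_denominator: "g \<in> set gs \<Longrightarrow> rden g dvd common_denominator gs"
  unfolding common_denominator_def by (induction gs) auto

lemma common_denominator_mult_int:
  assumes "g \<in> insert (of_int a) (set gs)"
  shows "of_int (common_denominator gs) * of_rat g \<in> (\<int> :: real set)"
proof (cases "g = of_int a")
  case True
  then show ?thesis by simp
next
  case False
  with assms have "rden g dvd common_denominator gs" by (auto intro: rden_dvd_common_denominator)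
  then obtain k where "common_denominator gs = rden g * k" by (elim dvdE)
  then have "of_int (common_denominator gs) * of_rat g = (of_int (k * rnum g) :: real)"
    using rden_pos[of g] by (simp add: of_rat_eq_rnum_rden)
  then show ?thesis by simp
qed

lemma abs_less_strict_upper_bound:
  assumes "g \<in> set gs"
  shows "\<bar>g\<bar> < of_int (strict_upper_bound gs)"
proof -
  have "\<bar>rnum g\<bar> * 1 \<le> \<bar>rnum g\<bar> * \<bar>rnum g\<bar>"
    by (cases "rnum g = 0") (simp, intro mult_left_mono, auto)
  then have "\<bar>rnum g\<bar> \<le> rnum g * rnum g" by simp
  also have "\<dots> \<le> sum_list (map (\<lambda>g. rnum g * rnum g) gs)"
    using assms by (intro member_le_sum_list) auto
  finally have *: "\<bar>rnum g\<bar> < strict_upper_bound gs" unfolding strict_upper_bound_def by simp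
  have "\<bar>g\<bar> = of_int \<bar>rnum g\<bar> / of_int (rden g)"
    using rat_eq_rnum_rden[of g] rden_pos[of g] by (metis abs_divide abs_of_pos of_int_0_less_iff of_int_abs)
  also have "\<dots> \<le> of_int \<bar>rnum g\<bar>"
    using rden_pos[of g] by (simp add: divide_le_eq mult_le_cancel_left1)
  also have "\<dots> < of_int (strict_upper_bound gs)" using * by (simp only: of_int_less_iff)
  finally show ?thesis .
qed

definition succ_level :: "rat list \<Rightarrow> rat \<Rightarrow> rat" where
  "succ_level gs = next_level gs (strict_upper_bound gs)"

lemma succ_level_mem: "succ_level gs l \<in> insert (of_int (strict_upper_bound gs)) {g \<in> set gs. l < g}"
  unfolding succ_level_def by (rule next_level_mem)

lemma succ_level_le: "g \<in> set gs \<Longrightarrow> l < g \<Longrightarrow> succ_level gs l \<le> g"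
  unfolding succ_level_def next_level_def by (rule Min_le) auto

lemma succ_level_split:
  assumes "g \<in> set gs"
  shows "g \<le> succ_level gs l \<longleftrightarrow> g \<le> l \<or> g = succ_level gs l"
    and "g = succ_level gs l \<Longrightarrow> \<not> g \<le> l"
proof -
  have mem: "succ_level gs l = of_int (strict_upper_bound gs) \<or> l < succ_level gs l"
    using succ_level_mem[of gs l] by auto
  have less: "g < of_int (strict_upper_bound gs)" using abs_less_strict_upper_bound[OF assms] by linarith
  show "g \<le> succ_level gs l \<longleftrightarrow> g \<le> l \<or> g = succ_level gs l"
    using mem less succ_level_le[OF assms, of l] by (cases "l < g") auto
  show "\<not> g \<le> l" if "g = succ_level gs l" using mem less that by auto
qed

lemma card_above_succ_level:
  "card {g \<in> set gs. succ_level gs l < g} \<le> card {g \<in> set gs. l < g} - 1"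
proof (cases "succ_level gs l \<in> {g \<in> set gs. l < g}")
  case True
  then have "{g \<in> set gs. succ_level gs l < g} \<subseteq> {g \<in> set gs. l < g} - {succ_level gs l}" by auto
  then have "card {g \<in> set gs. succ_level gs l < g} \<le> card ({g \<in> set gs. l < g} - {succ_level gs l})"
    by (intro card_mono) auto
  then show ?thesis using True by simp
next
  case False
  then have "succ_level gs l = of_int (strict_upper_bound gs)" using succ_level_mem[of gs l] by auto
  then have "{g \<in> set gs. succ_level gs l < g} = {}" using abs_less_strict_upper_bound[of _ gs] by fastforce
  then show ?thesis by (simp only: card.empty)
qed

locale pf_reduction =
  fixes kB :: real and \<Omega> :: "strands \<Rightarrow> sec_structure set" and inputs :: "pf_input set"
    and enc_model :: "energy_model \<Rightarrow> val" and gs :: "pf_input \<Rightarrow> rat list"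
  assumes kB_pos: "0 < kB"
    and structures: "\<Omega> s \<subseteq> secondary_structures s"
    and temp_pos: "(s, T, M) \<in> inputs \<Longrightarrow> 0 < T"
    and inj_model: "inj_on enc_model {M. \<exists>s T. (s, T, M) \<in> inputs}"
    and energy_mem: "(s, T, M) \<in> inputs \<Longrightarrow> S \<in> \<Omega> s \<Longrightarrow> M s S (of_rat T) \<in> of_rat ` set (gs (s, T, M))"
begin

abbreviation "Q \<equiv> dPF_magnified kB \<Omega> inputs enc_model"

definition energy :: "pf_input \<Rightarrow> sec_structure \<Rightarrow> real" where
  "energy = (\<lambda>(s, T, M) S. M s S (of_rat T))"

definition multiplicity_of :: "pf_input \<Rightarrow> rat \<Rightarrow> nat" where
  "multiplicity_of x g = card {S \<in> \<Omega> (fst x). energy x S = of_rat g}"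

definition partial_sum :: "pf_input \<Rightarrow> (real \<Rightarrow> real) \<Rightarrow> rat \<Rightarrow> real" where
  "partial_sum x f l = (\<Sum>S | S \<in> \<Omega> (fst x) \<and> energy x S \<le> of_rat l. f (energy x S))"

abbreviation "bits x \<equiv> (num_bases (fst x))\<^sup>2"
abbreviation "denom x \<equiv> common_denominator (gs x)"
abbreviation "upper x \<equiv> strict_upper_bound (gs x)"

definition ln_weight :: "pf_input \<Rightarrow> rexp" where
  "ln_weight x = RMul (Num (denom x)) (RLn (Num (2 ^ bits x * 2)))"

definition temp :: "pf_input \<Rightarrow> rexp" where
  "temp x = RMul Boltz (RDiv (Num (rnum (fst (snd x)))) (Num (rden (fst (snd x)))))"

definition minus_level :: "rat \<Rightarrow> rexp" where
  "minus_level g = RDiv (Num (- rnum g)) (Num (rden g))"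

definition query_weight :: "pf_input \<Rightarrow> rat \<Rightarrow> rexp" where
  "query_weight x g = RExp (RMul (minus_level g) (ln_weight x))"

definition boltzmann_weight :: "pf_input \<Rightarrow> rat \<Rightarrow> rexp" where
  "boltzmann_weight x g = RExp (RDiv (minus_level g) (temp x))"

definition magnification :: "pf_input \<Rightarrow> rexp" where
  "magnification x = RMul (temp x) (ln_weight x)"

abbreviation "qw x e \<equiv> exp (- e * (of_int (denom x) * ln (2 ^ bits x * 2)))"
abbreviation "bw x e \<equiv> exp (- e / (kB * of_rat (fst (snd x))))"

lemma ln_weight: "well_defined kB (ln_weight x)"
    "reval kB (ln_weight x) = of_int (denom x) * ln (2 ^ bits x * 2)"
  by (simp_all add: ln_weight_def)

lemma temp: "well_defined kB (temp x)" "reval kB (temp x) = kB * of_rat (fst (snd x))"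
  using rden_pos[of "fst (snd x)"] by (simp_all add: temp_def of_rat_eq_rnum_rden)

lemma minus_level: "well_defined kB (minus_level g)" "reval kB (minus_level g) = - of_rat g"
  using rden_pos[of g] by (simp_all add: minus_level_def of_rat_eq_rnum_rden)

lemma temp_val_pos: "x \<in> inputs \<Longrightarrow> 0 < kB * of_rat (fst (snd x))"
  using kB_pos temp_pos[of "fst x" "fst (snd x)" "snd (snd x)"] by simp

lemma query_weight: "well_defined kB (query_weight x g)"
    "reval kB (query_weight x g) = qw x (of_rat g)"
  by (simp_all add: query_weight_def ln_weight minus_level)

lemma boltzmann_weight: "x \<in> inputs \<Longrightarrow> well_defined kB (boltzmann_weight x g)"
    "reval kB (boltzmann_weight x g) = bw x (of_rat g)"
  using temp_val_pos[of x] by (auto simp: boltzmann_weight_def temp minus_level)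

lemma magnification: "well_defined kB (magnification x)"
    "reval kB (magnification x) = kB * of_rat (fst (snd x)) * (of_int (denom x) * ln (2 ^ bits x * 2))"
  by (simp_all add: magnification_def temp ln_weight)

lemma one_less_base: "(1::real) < 2 ^ n * 2"
  using one_le_power[of "2::real" n] by linarith

lemma magnification_pos: "x \<in> inputs \<Longrightarrow> 0 < reval kB (magnification x)"
  unfolding magnification using common_denominator_pos[of "gs x"] one_less_base[of "bits x"]
  by (intro mult_pos_pos[OF temp_val_pos] mult_pos_pos) auto

lemma finite_structures: "finite (\<Omega> s)"
  using structures card_secondary_structures(1) by (rule finite_subset)

lemma card_structures: "card (\<Omega> s) \<le> 2 ^ (num_bases s)\<^sup>2"
  using card_mono[OF card_secondary_structures(1) structures] card_secondary_structures(2) le_trans by blast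

lemma multiplicity_le: "int (multiplicity_of x g) \<le> 2 ^ bits x"
proof -
  have "multiplicity_of x g \<le> card (\<Omega> (fst x))"
    unfolding multiplicity_of_def by (intro card_mono finite_structures) auto
  also have "\<dots> \<le> 2 ^ bits x" by (rule card_structures)
  finally have "int (multiplicity_of x g) \<le> int (2 ^ bits x)" by (rule of_nat_mono)
  then show ?thesis by simp
qed

lemma energy_level:
  assumes "x \<in> inputs" "S \<in> \<Omega> (fst x)"
  obtains g where "g \<in> set (gs x)" "energy x S = of_rat g"
  using assms energy_mem by (cases x) (force simp: energy_def)

lemma energy_split:
  fixes l :: rat
  assumes "x \<in> inputs" "S \<in> \<Omega> (fst x)"
  defines "h \<equiv> succ_level (gs x) l"
  shows "energy x S \<le> of_rat h \<longleftrightarrow> energy x S \<le> of_rat l \<or> energy x S = of_rat h"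
    and "energy x S = of_rat h \<Longrightarrow> \<not> energy x S \<le> of_rat l"
proof -
  obtain g where g: "g \<in> set (gs x)" "energy x S = of_rat g" using energy_level[OF assms(1,2)] .
  show "energy x S \<le> of_rat h \<longleftrightarrow> energy x S \<le> of_rat l \<or> energy x S = of_rat h"
    "energy x S = of_rat h \<Longrightarrow> \<not> energy x S \<le> of_rat l"
    using succ_level_split[OF g(1), of l] unfolding h_def g(2) of_rat_less_eq of_rat_eq_iff by blast+
qed

lemma energy_gap:
  assumes "x \<in> inputs" "S \<in> \<Omega> (fst x)" and "of_rat (succ_level (gs x) l) < energy x S"
  shows "1 \<le> of_int (denom x) * (energy x S - of_rat (succ_level (gs x) l))"
proof -
  obtain g where g: "g \<in> set (gs x)" "energy x S = of_rat g" using energy_level[OF assms(1,2)] .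
  have "of_int (denom x) * of_rat g \<in> (\<int> :: real set)"
    "of_int (denom x) * of_rat (succ_level (gs x) l) \<in> (\<int> :: real set)"
    using g succ_level_mem[of "gs x" l] by (auto intro!: common_denominator_mult_int)
  then have "of_int (denom x) * (energy x S - of_rat (succ_level (gs x) l)) \<in> \<int>"
    unfolding g(2) right_diff_distrib by (rule Ints_diff)
  moreover have "0 < of_int (denom x) * (energy x S - of_rat (succ_level (gs x) l))"
    using assms(3) common_denominator_pos[of "gs x"] by simp
  ultimately show ?thesis by (auto elim!: Ints_cases)
qed

lemma partial_sum_step:
  fixes l :: rat
  assumes "x \<in> inputs"
  defines "h \<equiv> succ_level (gs x) l"
  shows "partial_sum x f h = partial_sum x f l + real (multiplicity_of x h) * f (of_rat h)"
  unfolding partial_sum_def multiplicity_of_def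
  by (rule sum_le_step[OF finite_structures]) (use energy_split[OF assms(1)] in \<open>simp_all add: h_def\<close>)

lemma PF_magnified:
  assumes "(s, T, M) \<in> inputs"
  shows "PF kB \<Omega> s (of_rat T) (magnify (reval kB (magnification (s, T, M))) M) =
    (\<Sum>S\<in>\<Omega> s. qw (s, T, M) (energy (s, T, M) S))"
  unfolding PF_def magnify_def magnification
  using temp_val_pos[OF assms] by (intro sum.cong) (auto simp: energy_def)

lemma query_iff:
  fixes l :: rat
  assumes x: "x \<in> inputs" and e: "well_defined kB e" "reval kB e = partial_sum x (qw x) l"
  defines "h \<equiv> succ_level (gs x) l"
  shows "P (enc_input enc_model x) (P (enc_rexp (magnification x))
      (enc_rexp (RAdd e (RMul (Num m) (query_weight x h))))) \<in> Q \<longleftrightarrow> m \<le> int (multiplicity_of x h)"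
proof -
  obtain s T M where xs: "x = (s, T, M)" by (rule prod_cases3)
  have "real (card (\<Omega> (fst x))) \<le> 2 ^ bits x"
    using of_nat_mono[OF card_structures[of "fst x"], where 'a = real] by simp
  moreover have "(0::real) < 2 ^ bits x" by simp
  ultimately have card: "real (card (\<Omega> (fst x))) < 2 ^ bits x * 2" by linarith
  have "P (enc_input enc_model x) (P (enc_rexp (magnification x))
      (enc_rexp (RAdd e (RMul (Num m) (query_weight x h))))) \<in> Q \<longleftrightarrow>
    dPF kB \<Omega> s (of_rat T) (magnify (reval kB (magnification x)) M)
      (reval kB (RAdd e (RMul (Num m) (query_weight x h))))"
    unfolding xs using x e magnification_pos[OF x]
    by (intro mem_dPF_magnified_iff[OF inj_model]) (simp_all add: xs magnification(1) query_weight(1))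
  also have "\<dots> \<longleftrightarrow> partial_sum x (qw x) l + of_int m * qw x (of_rat h) \<le>
      (\<Sum>S\<in>\<Omega> (fst x). qw x (energy x S))"
    using PF_magnified x e by (simp add: xs dPF_def query_weight(2))
  also have "\<dots> \<longleftrightarrow> m \<le> int (multiplicity_of x h)"
    unfolding partial_sum_def multiplicity_of_def
    by (rule threshold_iff_le_count[OF finite_structures card])
      (use energy_split[OF x] energy_gap[OF x] one_less_base[of "bits x"] in \<open>simp_all add: h_def less_imp_le\<close>)
  finally show ?thesis .
qed

lemma partial_sum_all:
  assumes "x \<in> inputs" and "{g \<in> set (gs x). l < g} = {}"
  shows "partial_sum x (bw x) l = PF kB \<Omega> (fst x) (of_rat (fst (snd x))) (snd (snd x))"
proof -
  have "energy x S \<le> of_rat l" if "S \<in> \<Omega> (fst x)" for S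
    using energy_level[OF assms(1) that] assms(2) by (metis (mono_tags, lifting) empty_Collect_eq not_le of_rat_less_eq)
  then have "{S. S \<in> \<Omega> (fst x) \<and> energy x S \<le> of_rat l} = \<Omega> (fst x)" by auto
  then show ?thesis unfolding partial_sum_def PF_def by (simp add: energy_def split: prod.split)
qed

lemma partial_sum_none:
  assumes "x \<in> inputs"
  shows "partial_sum x f (of_int (- upper x)) = 0"
proof -
  have "\<not> energy x S \<le> of_rat (of_int (- upper x))" if S: "S \<in> \<Omega> (fst x)" for S
  proof -
    obtain g where g: "g \<in> set (gs x)" "energy x S = of_rat g" using energy_level[OF assms S] .
    show ?thesis unfolding g(2) of_rat_less_eq using abs_less_strict_upper_bound[OF g(1)] by auto
  qed
  then have "{S. S \<in> \<Omega> (fst x) \<and> energy x S \<le> of_rat (of_int (- upper x))} = {}" by auto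
  then show ?thesis unfolding partial_sum_def by (metis sum.empty)
qed

end

abbreviation (input) "p_temp \<equiv> p_mul p_boltz
  (p_div (p_num (Left (Left (Right (Var v_input))))) (p_num (Right (Left (Right (Var v_input))))))"
abbreviation (input) "p_ln_weight \<equiv>
  p_mul (p_num (Var v_denom)) (p_ln (p_num (Mul (Var v_bound) (Const 2))))"
abbreviation (input) "p_minus_next \<equiv>
  p_div (p_num (Sub (Const 0) (Left (Var v_next)))) (p_num (Right (Var v_next)))"

definition setup_search :: com where
  "setup_search =
    Seq (Assign v_alpha (p_mul p_temp p_ln_weight))
    (Seq (Assign v_thr (p_num (Const 0)))
    (Seq (Assign v_out (p_num (Const 0)))
    (Seq (Assign v_last (MkPair (Sub (Const 0) (Var v_top)) (Const 1)))
         (Assign v_rounds (Var v_levels)))))"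

definition update :: com where
  "update =
    Seq (Assign v_thr (p_add (Var v_thr) (p_mul (p_num (Var v_count)) (Var v_weight))))
    (Seq (Assign v_out (p_add (Var v_out)
           (p_mul (p_num (Var v_count)) (p_exp (p_div p_minus_next p_temp)))))
    (Seq (Assign v_last (Var v_next))
         (Assign v_rounds (Right (Var v_rounds)))))"

definition search_round :: com where
  "search_round =
    Seq find_next
    (Seq (Assign v_weight (p_exp (p_mul p_minus_next p_ln_weight)))
    (Seq binary_search update))"

lemma writes_search_round: "writes search_round =
  {v_list, v_next, v_weight, v_answer, v_count, v_step, v_thr, v_out, v_last, v_rounds}"
  by (auto simp: search_round_def find_next_def binary_search_def update_def)

lemma ptriple_rename:
  assumes "inj f" "oracle_free c"
    and "\<forall>x\<in>D. \<exists>n t. exec {} c (init (enc x)) n t \<and> n \<le> poly p (vsize (enc x)) \<and> R x (t 0)"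
  shows "ptriple Q D (\<lambda>x s. s \<circ> f = init (enc x)) (rename f c) (\<lambda>x t. R x (t (f 0)))"
proof (rule ptripleI[OF poly_bounded_poly[of p]])
  fix x s K assume x: "x \<in> D" and s: "bounded_state s K" "s \<circ> f = init (enc x)"
  from assms(3) x obtain n t where t: "exec {} c (init (enc x)) n t" "n \<le> poly p (vsize (enc x))" "R x (t 0)"
    by blast
  from exec_rename[OF assms(1) t(1) assms(2) s(2)] obtain t' where
    t': "exec Q (rename f c) s n t'" "t' \<circ> f = t" by blast
  have "s (f 0) = enc x" using fun_cong[OF s(2), of 0] by (simp add: init_def)
  with s(1) have "vsize (enc x) \<le> K" unfolding bounded_state_def by metis
  then have "n \<le> poly p K" using t(2) poly_nat_mono le_trans by blast
  moreover have "R x (t' (f 0))" using t(3) t'(2) by auto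
  ultimately show "\<exists>n t. exec Q (rename f c) s n t \<and> n \<le> poly p K \<and> R x (t (f 0))"
    using t'(1) by blast
qed

context pf_reduction
begin

lemma enc_input_eq: "enc_input enc_model x =
  P (enc_list (enc_list enc_base) (fst x)) (P (enc_rat (fst (snd x))) (enc_model (snd (snd x))))"
  by (cases x) simp

definition env :: "pf_input \<Rightarrow> state \<Rightarrow> bool" where
  "env x s \<longleftrightarrow> s v_input = enc_input enc_model x \<and> s v_levels = enc_levels (gs x) \<and>
    s v_bound = I (2 ^ bits x) \<and> s v_denom = I (denom x) \<and> s v_top = I (upper x)"

definition search_state :: "pf_input \<Rightarrow> rat \<Rightarrow> rexp \<Rightarrow> rexp \<Rightarrow> state \<Rightarrow> bool" where
  "search_state x l et eo s \<longleftrightarrow> env x s \<and> s v_alpha = enc_rexp (magnification x) \<and>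
    s v_thr = enc_rexp et \<and> s v_out = enc_rexp eo \<and> s v_last = enc_rat l"

lemma setup_search_correct:
  "ptriple Q inputs env setup_search (\<lambda>x t.
    search_state x (of_int (- upper x)) (Num 0) (Num 0) t \<and> t v_rounds = enc_levels (gs x))"
  by (rule ptriple_straight)
    (auto simp: setup_search_def env_def search_state_def enc_input_eq enc_rat_eq magnification_def
      temp_def ln_weight_def rnum_of_int[of "- strict_upper_bound _", simplified]
      rden_of_int[of "- strict_upper_bound _", simplified])

lemma search_round_correct:
  "ptriple Q
    {(x, l, q, qs, et, eo). x \<in> inputs \<and> well_defined kB et \<and> reval kB et = partial_sum x (qw x) l}
    (\<lambda>(x, l, q, qs, et, eo) s. search_state x l et eo s \<and> s v_rounds = enc_levels (q # qs))
    search_round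
    (\<lambda>(x, l, q, qs, et, eo) t. let h = succ_level (gs x) l; N = int (multiplicity_of x h) in
      search_state x h (RAdd et (RMul (Num N) (query_weight x h)))
        (RAdd eo (RMul (Num N) (boltzmann_weight x h))) t \<and>
      t v_rounds = enc_levels qs \<and> t v_next = enc_rat h \<and> t v_list = I 0 \<and> t v_step = I 0 \<and>
      vsize (t v_answer) \<le> 2 \<and> t v_count = I N \<and> t v_weight = enc_rexp (query_weight x h))"
    (is "ptriple Q ?D ?A _ ?C")
proof -
  define B1 where "B1 = (\<lambda>(x, l, q, qs, et, eo) s. search_state x l et eo s \<and>
    s v_rounds = enc_levels (q # qs) \<and> s v_next = enc_rat (succ_level (gs x) l) \<and> s v_list = I 0)"
  define B2 where "B2 = (\<lambda>j s. B1 j s \<and>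
    s v_weight = (case j of (x, l, q, qs, et, eo) \<Rightarrow> enc_rexp (query_weight x (succ_level (gs x) l))))"
  define B3 where "B3 = (\<lambda>j s. B2 j s \<and> s v_step = I 0 \<and> vsize (s v_answer) \<le> 2 \<and>
    s v_count = (case j of (x, l, q, qs, et, eo) \<Rightarrow> I (int (multiplicity_of x (succ_level (gs x) l)))))"
  have 1: "ptriple Q ?D ?A find_next B1"
  proof (rule ptriple_apply[OF find_next_correct], goal_cases)
    case (1 j s)
    obtain x l q qs et eo where j: "j = (x, l, q, qs, et, eo)" by (metis prod.exhaust)
    show ?case
    proof (rule bexI[of _ "(gs x, upper x, l)"], rule conjI, goal_cases)
      case 2
      show ?case
      proof (intro allI impI, goal_cases)
        case t: (1 t)
        have "t y = s y" if "y \<notin> {v_list, v_next}" for y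
          using t(2) that by (simp add: find_next_def)
        with t(1) 1 show ?case
          by (simp add: j B1_def search_state_def env_def succ_level_def)
      qed
    qed (use 1 in \<open>auto simp: j search_state_def env_def\<close>)
  qed
  have 2: "ptriple Q ?D B1 (Assign v_weight (p_exp (p_mul p_minus_next p_ln_weight))) B2"
    by (rule ptriple_straight)
      (auto simp: B1_def B2_def search_state_def env_def enc_rat_eq query_weight_def minus_level_def
        ln_weight_def)
  have 3: "ptriple Q ?D B2 binary_search B3"
  proof (rule ptriple_apply[OF binary_search_correct], goal_cases)
    case (1 j s)
    obtain x l q qs et eo where j: "j = (x, l, q, qs, et, eo)" by (metis prod.exhaust)
    let ?h = "succ_level (gs x) l"
    let ?i = "(enc_input enc_model x, enc_rexp (magnification x), enc_rexp et,
      enc_rexp (query_weight x ?h), bits x, int (multiplicity_of x ?h))"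
    have "?i \<in> searchable Q"
      using query_iff[of x et l] multiplicity_le[of x ?h] 1(1)
      by (simp add: searchable_def j)
    then show ?case
    proof (rule bexI[rotated], intro conjI, goal_cases)
      case 2
      show ?case
      proof (intro allI impI, goal_cases)
        case t: (1 t)
        have "t y = s y" if "y \<notin> {v_answer, v_count, v_step}" for y
          using t(2) that by (simp add: binary_search_def)
        with t(1) 1(2) show ?case
          by (simp add: j B1_def B2_def B3_def search_state_def env_def)
      qed
    qed (use 1 in \<open>auto simp: j B1_def B2_def search_state_def env_def\<close>)
  qed
  have 4: "ptriple Q ?D B3 update ?C"
    by (rule ptriple_straight)
      (auto simp: update_def B1_def B2_def B3_def search_state_def env_def Let_def enc_input_eq enc_rat_eq
        boltzmann_weight_def minus_level_def temp_def)
  show ?thesis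
    unfolding search_round_def by (intro ptriple_seq[OF 1 ptriple_seq[OF 2 ptriple_seq[OF 3 4]]])
qed

definition search_inv :: "pf_input \<Rightarrow> nat \<Rightarrow> rat \<Rightarrow> rat list \<Rightarrow> rexp \<Rightarrow> rexp \<Rightarrow> state \<Rightarrow> bool" where
  "search_inv x K l qs et eo s \<longleftrightarrow>
    search_state x l et eo s \<and> s v_rounds = enc_levels qs \<and>
    well_defined kB et \<and> reval kB et = partial_sum x (qw x) l \<and>
    well_defined kB eo \<and> reval kB eo = partial_sum x (bw x) l \<and>
    card {g \<in> set (gs x). l < g} \<le> length qs \<and>
    vsize (enc_levels qs) \<le> K \<and>
    (\<forall>y\<in>{v_input, v_levels, v_bound, v_denom, v_top}. vsize (s y) \<le> K) \<and>
    (\<forall>y\<in>{v_last, v_next, v_list, v_count, v_step, v_answer, v_weight}. vsize (s y) \<le> 50 * K + 200) \<and>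
    vsize (enc_rexp et) + (50 * K + 200) * vsize (enc_levels qs) \<le> K + (50 * K + 200) * K \<and>
    vsize (enc_rexp eo) + (50 * K + 200) * vsize (enc_levels qs) \<le> K + (50 * K + 200) * K"

lemma search_inv_step:
  assumes x: "x \<in> inputs" and inv: "search_inv x K l (q # qs) et eo s"
  defines "h \<equiv> succ_level (gs x) l" and "N \<equiv> int (multiplicity_of x (succ_level (gs x) l))"
  assumes t: "search_state x h (RAdd et (RMul (Num N) (query_weight x h)))
        (RAdd eo (RMul (Num N) (boltzmann_weight x h))) t"
      "t v_rounds = enc_levels qs" "t v_next = enc_rat h" "t v_list = I 0" "t v_step = I 0"
      "vsize (t v_answer) \<le> 2" "t v_count = I N" "t v_weight = enc_rexp (query_weight x h)"
  shows "search_inv x K h qs (RAdd et (RMul (Num N) (query_weight x h)))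
        (RAdd eo (RMul (Num N) (boltzmann_weight x h))) t"
proof -
  let ?C = "50 * K + 200"
  note inv = inv[unfolded search_inv_def search_state_def env_def]
  note t' = t(1)[unfolded search_state_def env_def]
  have K: "vsize (enc_input enc_model x) \<le> K" "vsize (enc_levels (gs x)) \<le> K"
    "vsize (I (2 ^ bits x)) \<le> K" "vsize (I (denom x)) \<le> K" "vsize (I (upper x)) \<le> K"
    using inv by auto
  have h: "vsize (enc_rat h) \<le> 2 * K + 3"
    using vsize_next_level[of "gs x" "upper x" l] K unfolding h_def succ_level_def by linarith
  then have pq: "vsize (I (rnum h)) + vsize (I (rden h)) \<le> 2 * K + 3" by (simp add: enc_rat_eq)
  have N: "vsize (I N) \<le> K"
    using vsize_mono[of N "2 ^ bits x"] multiplicity_le[of x h] K(3)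
    by (simp add: N_def h_def)
  have b: "vsize (I (2 ^ bits x * 2)) \<le> K + 3" using vsize_mult[of "2 ^ bits x" 2] K(3) by simp
  have T: "vsize (I (rnum (fst (snd x)))) + vsize (I (rden (fst (snd x)))) \<le> K"
    using K(1) by (simp add: enc_input_eq enc_rat_eq)
  have w: "vsize (enc_rexp (query_weight x h)) \<le> 4 * K + 100"
    using pq b K by (simp add: query_weight_def minus_level_def ln_weight_def vsize_uminus)
  have w': "vsize (enc_rexp (boltzmann_weight x h)) \<le> 4 * K + 100"
    using pq T by (simp add: boltzmann_weight_def minus_level_def temp_def vsize_uminus)
  have grow: "?C * vsize (enc_levels qs) + ?C \<le> ?C * vsize (enc_levels (q # qs))"
  proof -
    have "?C * vsize (enc_levels qs) + ?C = ?C * (vsize (enc_levels qs) + 1)" by simp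
    also have "\<dots> \<le> ?C * vsize (enc_levels (q # qs))" by (intro mult_le_mono2) simp
    finally show ?thesis .
  qed
  have et: "vsize (enc_rexp (RAdd et (RMul (Num N) (query_weight x h)))) \<le> vsize (enc_rexp et) + ?C"
    using N w by simp
  have eo: "vsize (enc_rexp (RAdd eo (RMul (Num N) (boltzmann_weight x h)))) \<le> vsize (enc_rexp eo) + ?C"
    using N w' by simp
  have card: "card {g \<in> set (gs x). h < g} \<le> length qs"
    using card_above_succ_level[of "gs x" l] inv unfolding h_def by auto
  show ?thesis
    unfolding search_inv_def
  proof (intro conjI)
    show "reval kB (RAdd et (RMul (Num N) (query_weight x h))) = partial_sum x (qw x) h"
      using inv partial_sum_step[OF x, of "qw x" l] by (simp add: query_weight N_def h_def)
    show "reval kB (RAdd eo (RMul (Num N) (boltzmann_weight x h))) = partial_sum x (bw x) h"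
      using inv partial_sum_step[OF x, of "bw x" l] by (simp add: boltzmann_weight N_def h_def)
    show "\<forall>y\<in>{v_last, v_next, v_list, v_count, v_step, v_answer, v_weight}. vsize (t y) \<le> 50 * K + 200"
      using h N w t t' by simp
    show "\<forall>y\<in>{v_input, v_levels, v_bound, v_denom, v_top}. vsize (t y) \<le> K"
      using K t' by simp
    show "vsize (enc_rexp (RAdd et (RMul (Num N) (query_weight x h)))) + ?C * vsize (enc_levels qs)
      \<le> K + ?C * K"
      using et grow inv by linarith
    show "vsize (enc_rexp (RAdd eo (RMul (Num N) (boltzmann_weight x h)))) + ?C * vsize (enc_levels qs)
      \<le> K + ?C * K"
      using eo grow inv by linarith
    show "vsize (enc_levels qs) \<le> K" using inv by simp
    show "well_defined kB (RAdd et (RMul (Num N) (query_weight x h)))"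
      using inv by (simp add: query_weight)
    show "well_defined kB (RAdd eo (RMul (Num N) (boltzmann_weight x h)))"
      using inv x by (simp add: boltzmann_weight)
  qed (use t card in simp_all)
qed

lemma search_correct:
  "ptriple Q inputs
    (\<lambda>x s. search_state x (of_int (- upper x)) (Num 0) (Num 0) s \<and> s v_rounds = enc_levels (gs x))
    (While (IsPair (Var v_rounds)) search_round)
    (\<lambda>x t. PF_output kB \<Omega> x (t v_out))"
proof (rule ptriple_while[where v = v_rounds and Inv = "\<lambda>x K s. \<exists>l qs et eo. search_inv x K l qs et eo s"
      and g = "\<lambda>K. K + (50 * K + 200) * K + (50 * K + 200)"], goal_cases)
  case 1
  show ?case by (intro poly_bounded_intros)
next
  case (2 x s K)
  have K: "vsize (s y) \<le> K" for y using 2(2) by (auto simp: bounded_state_def)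
  have "vsize (s y) \<le> 50 * K + 200" for y using K[of y] by simp
  moreover have "vsize (enc_levels (gs x)) \<le> K" "vsize (enc_rexp (Num 0)) \<le> K"
    using K[of v_rounds] K[of v_thr] 2(3) by (simp_all add: search_state_def)
  moreover have "card {g \<in> set (gs x). of_int (- upper x) < g} \<le> length (gs x)"
    by (rule le_trans[OF card_mono[OF finite_set] card_length]) auto
  ultimately have "search_inv x K (of_int (- upper x)) (gs x) (Num 0) (Num 0) s"
    unfolding search_inv_def using 2 K partial_sum_none[OF 2(1)]
    by (auto intro!: add_mono mult_le_mono2 simp del: enc_rexp.simps)
  then show ?case by blast
next
  case (3 x s K y)
  then obtain l qs et eo where "search_inv x K l qs et eo s" by blast
  with 3(4) show ?case
    by (auto simp: writes_search_round search_inv_def search_state_def)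
next
  case 4
  show ?case
  proof (rule ptriple_apply[OF search_round_correct], goal_cases)
    case (1 j s)
    obtain x K m where j: "j = (x, K, m)" by (metis prod.exhaust)
    from 1 obtain l qs et eo where *: "x \<in> inputs" "search_inv x K l qs et eo s"
      "is_pair (s v_rounds)" "vsize (s v_rounds) = m"
      by (auto simp: j)
    then obtain q qs' where qs: "qs = q # qs'" by (cases qs) (auto simp: search_inv_def)
    show ?case
    proof (rule bexI[of _ "(x, l, q, qs', et, eo)"], rule conjI, goal_cases)
      case 2
      show ?case
      proof (intro allI impI, goal_cases)
        case (1 t)
        then have t: "search_inv x K (succ_level (gs x) l) qs'
          (RAdd et (RMul (Num (int (multiplicity_of x (succ_level (gs x) l)))) (query_weight x (succ_level (gs x) l))))
          (RAdd eo (RMul (Num (int (multiplicity_of x (succ_level (gs x) l)))) (boltzmann_weight x (succ_level (gs x) l)))) t"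
          using search_inv_step[OF *(1) *(2)[unfolded qs], of t] by (simp add: Let_def)
        then have "vsize (t v_rounds) < m"
          using *(2,4) by (auto simp: search_inv_def qs)
        with t show ?case by (auto simp: j)
      qed
    qed (use * qs in \<open>auto simp: search_inv_def\<close>)
  qed
next
  case (5 x K t)
  then obtain l qs et eo where inv: "search_inv x K l qs et eo t" "\<not> is_pair (t v_rounds)"
    by auto
  then have "qs = []" by (auto simp: search_inv_def enc_list_is_pair)
  with inv have "{g \<in> set (gs x). l < g} = {}" by (auto simp: search_inv_def)
  from partial_sum_all[OF 5(1) this] inv(1) show ?case
    by (cases x) (auto simp: search_inv_def search_state_def)
qed

lemma reduction_correct:
  assumes "oracle_free c"
    and "\<forall>x\<in>inputs. \<exists>n t. exec {} c (init (enc_input enc_model x)) n t \<and>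
      n \<le> poly p (vsize (enc_input enc_model x)) \<and> t 0 = enc_levels (gs x)"
  shows "polytime_Turing_reducible inputs (enc_input enc_model) (PF_output kB \<Omega>) Q"
proof -
  define f :: "nat \<Rightarrow> nat" where "f = (\<lambda>i. if i = 0 then 0 else i + 17)"
  have f: "inj f" "f 0 = 0" "v_input \<notin> range f" by (auto simp: f_def inj_def)
  have levels: "ptriple Q inputs
    (\<lambda>x s. s \<circ> f = init (enc_input enc_model x) \<and> s v_input = enc_input enc_model x) (rename f c)
    (\<lambda>x t. t 0 = enc_levels (gs x) \<and> t v_input = enc_input enc_model x)"
  proof (rule ptriple_apply[OF ptriple_rename[OF f(1) assms]], goal_cases)
    case (1 x s)
    have "v_input \<notin> writes (rename f c)" using f(3) unfolding writes_rename by blast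
    with 1 f(2) show ?case by (intro bexI[of _ x]) metis+
  qed
  have count: "ptriple Q inputs
    (\<lambda>x s. s v_levels = enc_levels (gs x) \<and> s v_input = enc_input enc_model x) count_bases
    (\<lambda>x t. t v_bound = I (2 ^ bits x) \<and> t v_levels = enc_levels (gs x) \<and> t v_input = enc_input enc_model x)"
    by (rule ptriple_apply[OF count_bases_correct])
      (auto simp: enc_input_eq count_bases_def count_strand_def)
  have scan: "ptriple Q inputs
    (\<lambda>x s. s v_bound = I (2 ^ bits x) \<and> s v_levels = enc_levels (gs x) \<and> s v_input = enc_input enc_model x)
    scan_levels env"
    by (rule ptriple_apply[OF scan_levels_correct]) (auto simp: env_def scan_levels_def)
  have final: "ptriple Q inputs (\<lambda>x s. PF_output kB \<Omega> x (s v_out)) (Assign 0 (Var v_out))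
    (\<lambda>x t. PF_output kB \<Omega> x (t 0))"
    by (rule ptriple_straight) simp_all
  have "ptriple Q inputs (\<lambda>x s. s 0 = enc_levels (gs x) \<and> s v_input = enc_input enc_model x)
    (Seq (Assign v_levels (Var 0)) (Seq count_bases (Seq scan_levels (Seq setup_search
      (Seq (While (IsPair (Var v_rounds)) search_round) (Assign 0 (Var v_out)))))))
    (\<lambda>x t. PF_output kB \<Omega> x (t 0))"
    by (rule ptriple_pre[OF ptriple_straight_seq[OF ptriple_seq[OF count ptriple_seq[OF scan
        ptriple_seq[OF setup_search_correct ptriple_seq[OF search_correct final]]]]]]) auto
  note rest = ptriple_seq[OF levels this]
  show ?thesis
  proof (rule polytime_Turing_reducibleI[OF ptriple_pre[OF ptriple_straight_seq[OF rest,
            of "Assign v_input (Var 0)"]]])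
    fix x s assume "s = init (enc_input enc_model x)"
    then show "run Q (Assign v_input (Var 0)) s \<circ> f = init (enc_input enc_model x) \<and>
      run Q (Assign v_input (Var 0)) s v_input = enc_input enc_model x"
      by (auto simp: f_def init_def fun_eq_iff)
  qed simp
qed

end

theorem theorem24:
  fixes kB :: real
    and \<Omega> :: "strands \<Rightarrow> sec_structure set"
    and inputs :: "pf_input set"
    and enc_model :: "energy_model \<Rightarrow> val"
    and levels :: "pf_input \<Rightarrow> rat set"
  assumes "kB > 0"
    and "\<And>s. \<Omega> s \<subseteq> secondary_structures s"
    and "\<And>s T M. (s, T, M) \<in> inputs \<Longrightarrow> T > 0"
    and "inj_on enc_model {M. \<exists>s T. (s, T, M) \<in> inputs}"
    and "candidate_levels \<Omega> inputs enc_model levels"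
  shows "polytime_Turing_reducible inputs (enc_input enc_model) (PF_output kB \<Omega>)
           (dPF_magnified kB \<Omega> inputs enc_model)"
proof -
  from assms(5) obtain c p where c: "oracle_free c" and
    "\<forall>x\<in>inputs. \<exists>n t. exec {} c (init (enc_input enc_model x)) n t \<and>
      n \<le> poly p (vsize (enc_input enc_model x)) \<and> (\<exists>gs. t 0 = enc_levels gs \<and> set gs = levels x)"
    unfolding candidate_levels_def polytime_solvable_def solves_in_polytime_def by blast
  then have "\<forall>x\<in>inputs. \<exists>gs. (\<exists>n t. exec {} c (init (enc_input enc_model x)) n t \<and>
      n \<le> poly p (vsize (enc_input enc_model x)) \<and> t 0 = enc_levels gs) \<and> set gs = levels x"
    by blast
  from bchoice[OF this] obtain gs where
    run: "\<forall>x\<in>inputs. \<exists>n t. exec {} c (init (enc_input enc_model x)) n t \<and>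
      n \<le> poly p (vsize (enc_input enc_model x)) \<and> t 0 = enc_levels (gs x)" and
    set: "\<forall>x\<in>inputs. set (gs x) = levels x" by blast
  interpret pf_reduction kB \<Omega> inputs enc_model gs
  proof
    fix s T M S assume "(s, T, M) \<in> inputs" "S \<in> \<Omega> s"
    with assms(5) set show "M s S (of_rat T) \<in> of_rat ` set (gs (s, T, M))"
      unfolding candidate_levels_def by fastforce
  qed (use assms in blast)+
  show ?thesis using reduction_correct[OF c run] .
qed

end
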